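(* Let $\Phi=v_0+\Delta\Phi$ be a Higgs field in unitary gauge with respect to the vacuum vector $v_0$ (all Goldstone bosons of $\Phi$ vanish identically on $M$), and let $A$ be a gauge field. Then, up to second order in the shifted Higgs field $\Delta\Phi$ and the gauge field $A$, and after removing the additive constant $-V(v_0)$, the Lagrangian $$\mathcal{L}=\left(\nabla^{A\mu}\Phi\right)^\dagger\left(\nabla^A_\mu\Phi\right)-V(\Phi)-\frac{1}{4}F^{\mu\nu}_iF_{\mu\nu}^i$$ is given by \begin{align*} \mathcal{L}\approx{}&\frac{1}{2}\sum_{j=1}^{2n-d}\left(\partial^\mu\eta_j\right)\left(\partial_\mu\eta_j\right)-\frac{1}{2}\sum_{j=1}^{2n-d}m_{f_j}^2\eta_j^2\\ &-\frac{1}{4}\sum_{i=1}^d\left(dA_i^{\mu\nu}\right)\left(dA^i_{\mu\nu}\right)+\frac{1}{2}\sum_{i=1}^dM_i^2A_i^\mu A^i_\mu\\ &-\frac{1}{4}\sum_{i=d+1}^r\left(dA_i^{\mu\nu}\right)\left(dA^i_{\mu\nu}\right). \end{align*}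
   Context: Setting. $M$ is a smooth manifold with a Riemannian or Lorentzian metric, used to raise and lower spacetime indices; $\partial_\mu$ are derivatives in local coordinates; repeated indices are summed. $G$ is a compact connected Lie group of dimension $r$ with Lie algebra $\mathfrak g$, $k$ is an $\mathrm{Ad}$-invariant positive definite scalar product on $\mathfrak g$. $G$ acts on $E=\mathbb C^n$ by a representation that is unitary for $\langle v,w\rangle=v^\dagger w$; $A\cdot v$ denotes the induced action of $A\in\mathfrak g$ on $v\in E$. $E$ carries the real scalar product $\mathrm{Re}\langle\cdot,\cdot\rangle$. $V\colon E\to\mathbb R$ is a smooth $G$-invariant function (the potential). A vacuum vector $v_0\in E$ is a local minimum of $V$; it is fixed. $H\subset G$ is the stabilizer of $v_0$, $\mathfrak h$ its Lie algebra, $\mathfrak h^\perp$ the $k$-orthogonal complement, $d=\dim\mathfrak h^\perp=\dim G/H$. Higgs sector. A Higgs field is a smooth map $\Phi\colon M\to E$; $V(\Phi)(x)=V(\Phi(x))$; the shifted Higgs field is $\Delta\Phi=\Phi-v_0$. Let $W_{v_0}=T_{v_0}(G\cdot v_0)\subset E$ and $W_{v_0}^\perp$ its orthogonal complement for $\mathrm{Re}\langle\cdot,\cdot\rangle$. Fix real orthonormal bases $e_1,\dots,e_d$ of $W_{v_0}$ and $f_1,\dots,f_{2n-d}$ of $W_{v_0}^\perp$ consisting of eigenvectors of the Hessian of $V$ at $v_0$ (as symmetric linear map of $(E,\mathrm{Re}\langle\cdot,\cdot\rangle)$), where $e_i$ has eigenvalue $0$ and $f_j$ has eigenvalue $2m_{f_j}^2$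 with $m_{f_j}\ge 0$. Write $\Delta\Phi=\frac{1}{\sqrt2}\sum_{i=1}^d\xi_ie_i+\frac{1}{\sqrt2}\sum_{j=1}^{2n-d}\eta_jf_j$ with real functions $\xi_i$ (Goldstone bosons) and $\eta_j$ (Higgs bosons) on $M$. Gauge sector. Let $m(A,B)=\mathrm{Re}\langle A\cdot v_0,B\cdot v_0\rangle$ on $\mathfrak g$. Fix $k$-orthonormal bases $\alpha_1,\dots,\alpha_d$ of $\mathfrak h^\perp$ and $\alpha_{d+1},\dots,\alpha_r$ of $\mathfrak h$ in which $m$ is diagonal, and define $M_i\ge0$ by $m(\alpha_i,\alpha_i)=\frac12M_i^2$ (so $M_i>0$ for $i\le d$ and $M_i=0$ for $i>d$). A gauge field is $A\in\Omega^1(M,\mathfrak g)$, $A_\mu=\sum_{i=1}^rA^i_\mu\alpha_i$; $\nabla^A_\mu=\partial_\mu+A_\mu$; $F_{\mu\nu}=\partial_\mu A_\nu-\partial_\nu A_\mu+[A_\mu,A_\nu]=\sum_iF^i_{\mu\nu}\alpha_i$; $dA^i_{\mu\nu}=\partial_\mu A^i_\nu-\partial_\nu A^i_\mu$. Lie algebra indices are raised and lowered trivially. "Up to second order" ($\approx$) means: after replacing $(\Delta\Phi,A)$ by $(t\Delta\Phi,tA)$, both sides have the same Taylor coefficients in $t$ of orders $0,1,2$ at $t=0$ (here with the constant $-V(v_0)$ dropped from the left side). *)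

theory Defs
  imports "HOL-Analysis.Analysis"
begin

section \<open>Smooth maps and smooth manifolds\<close>

text \<open>\<open>Ck_on k S f\<close> is meant for open \<open>S\<close> in a finite-dimensional space: all directional
  derivatives of the total derivative are again of class \<open>k - 1\<close>.\<close>

primrec Ck_on :: "nat \<Rightarrow> 'a::real_normed_vector set \<Rightarrow> ('a \<Rightarrow> 'b::real_normed_vector) \<Rightarrow> bool" where
  "Ck_on 0 S f \<longleftrightarrow> continuous_on S f"
| "Ck_on (Suc k) S f \<longleftrightarrow> (\<forall>x\<in>S. f differentiable (at x)) \<and>
     (\<forall>v. Ck_on k S (\<lambda>x. frechet_derivative f (at x) v))"

definition smooth_on :: "'a::real_normed_vector set \<Rightarrow> ('a \<Rightarrow> 'b::real_normed_vector) \<Rightarrow> bool" where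
  "smooth_on S f \<longleftrightarrow> (\<forall>k. Ck_on k S f)"

text \<open>A chart is a pair (domain, coordinate map); the coordinate map is irrelevant off the domain.\<close>

type_synonym ('p, 'b) chart = "'p set \<times> ('p \<Rightarrow> 'b)"

abbreviation cdom :: "('p, 'b) chart \<Rightarrow> 'p set" where "cdom c \<equiv> fst c"
abbreviation cmap :: "('p, 'b) chart \<Rightarrow> 'p \<Rightarrow> 'b" where "cmap c \<equiv> snd c"
abbreviation cimg :: "('p, 'b) chart \<Rightarrow> 'b set" where "cimg c \<equiv> cmap c ` cdom c"
abbreviation cinv :: "('p, 'b) chart \<Rightarrow> 'b \<Rightarrow> 'p" where "cinv c \<equiv> inv_into (cdom c) (cmap c)"

definition is_chart :: "('p::topological_space, 'b::real_normed_vector) chart \<Rightarrow> bool" where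
  "is_chart c \<longleftrightarrow> open (cdom c) \<and> open (cimg c) \<and>
     homeomorphism (cdom c) (cimg c) (cmap c) (cinv c)"

text \<open>A smooth manifold is a second countable Hausdorff space with a smooth atlas, modelled on a
  finite-dimensional space \<open>'b\<close>. The atlas need not be maximal, but may be.\<close>

definition smooth_atlas ::
  "('p::{t2_space, second_countable_topology}, 'b::real_normed_vector) chart set \<Rightarrow> bool" where
  "smooth_atlas \<A> \<longleftrightarrow> (\<exists>B::'b set. finite B \<and> span B = UNIV) \<and>
     (\<forall>c\<in>\<A>. is_chart c) \<and> (\<Union>c\<in>\<A>. cdom c) = UNIV \<and>
     (\<forall>c\<in>\<A>. \<forall>c'\<in>\<A>. smooth_on (cmap c ` (cdom c \<inter> cdom c')) (cmap c' \<circ> cinv c))"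

definition vector_space_atlas :: "('b, 'b::real_normed_vector) chart set" where
  "vector_space_atlas = {(UNIV, id)}"

definition prod_atlas :: "('p, 'b) chart set \<Rightarrow> ('q, 'c) chart set \<Rightarrow> ('p \<times> 'q, 'b \<times> 'c) chart set" where
  "prod_atlas \<A> \<B> = (\<lambda>(c, c'). (cdom c \<times> cdom c', map_prod (cmap c) (cmap c'))) ` (\<A> \<times> \<B>)"

definition smooth_map ::
  "('p::topological_space, 'b::real_normed_vector) chart set \<Rightarrow>
   ('q::topological_space, 'c::real_normed_vector) chart set \<Rightarrow> ('p \<Rightarrow> 'q) \<Rightarrow> bool" where
  "smooth_map \<A> \<B> f \<longleftrightarrow> continuous_on UNIV f \<and>
     (\<forall>c\<in>\<A>. \<forall>c'\<in>\<B>. smooth_on (cmap c ` (cdom c \<inter> f -` cdom c')) (cmap c' \<circ> f \<circ> cinv c))"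

text \<open>Tangent space at \<open>p\<close> of an embedded submanifold \<open>S\<close>: the velocities at \<open>p\<close>, expressed in the
  chart \<open>c\<close>, of smooth curves that run in \<open>S\<close>.\<close>

definition tangent_space_in :: "('p, 'b::real_normed_vector) chart \<Rightarrow> 'p set \<Rightarrow> 'p \<Rightarrow> 'b set" where
  "tangent_space_in c S p = {v. \<exists>\<gamma> \<epsilon>. \<epsilon> > 0 \<and> \<gamma> 0 = p \<and>
     (\<forall>t\<in>{-\<epsilon><..<\<epsilon>}. \<gamma> t \<in> S \<inter> cdom c) \<and> smooth_on {-\<epsilon><..<\<epsilon>} (cmap c \<circ> \<gamma>) \<and>
     v = vector_derivative (cmap c \<circ> \<gamma>) (at (0::real))}"

section \<open>Tensor fields on spacetime\<close>

text \<open>Spacetime is modelled on \<open>real ^ 'm\<close>; a tensor field is given by its coordinate expression in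
  every chart, subject to the transformation law.\<close>

definition transition_deriv ::
  "('p, 'b::real_normed_vector) chart \<Rightarrow> ('p, 'b) chart \<Rightarrow> 'p \<Rightarrow> 'b \<Rightarrow> 'b" where
  "transition_deriv c c' p = frechet_derivative (cmap c' \<circ> cinv c) (at (cmap c p))"

definition one_form ::
  "('p, real ^ 'm) chart set \<Rightarrow> (('p, real ^ 'm) chart \<Rightarrow> 'p \<Rightarrow> real ^ 'm \<Rightarrow> 'g::real_normed_vector) \<Rightarrow> bool" where
  "one_form \<A> A \<longleftrightarrow>
     (\<forall>c\<in>\<A>. \<forall>p\<in>cdom c. linear (A c p)) \<and>
     (\<forall>c\<in>\<A>. \<forall>u. smooth_on (cimg c) (\<lambda>x. A c (cinv c x) u)) \<and>
     (\<forall>c\<in>\<A>. \<forall>c'\<in>\<A>. \<forall>p\<in>cdom c \<inter> cdom c'. \<forall>u. A c p u = A c' p (transition_deriv c c' p u))"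

definition symmetric_two_tensor ::
  "('p, real ^ 'm) chart set \<Rightarrow> (('p, real ^ 'm) chart \<Rightarrow> 'p \<Rightarrow> real ^ 'm \<Rightarrow> real ^ 'm \<Rightarrow> real) \<Rightarrow> bool" where
  "symmetric_two_tensor \<A> g \<longleftrightarrow>
     (\<forall>c\<in>\<A>. \<forall>p\<in>cdom c. bilinear (g c p) \<and> (\<forall>u v. g c p u v = g c p v u)) \<and>
     (\<forall>c\<in>\<A>. \<forall>u v. smooth_on (cimg c) (\<lambda>x. g c (cinv c x) u v)) \<and>
     (\<forall>c\<in>\<A>. \<forall>c'\<in>\<A>. \<forall>p\<in>cdom c \<inter> cdom c'. \<forall>u v.
        g c p u v = g c' p (transition_deriv c c' p u) (transition_deriv c c' p v))"

definition riemannian_metric ::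
  "('p, real ^ 'm) chart set \<Rightarrow> (('p, real ^ 'm) chart \<Rightarrow> 'p \<Rightarrow> real ^ 'm \<Rightarrow> real ^ 'm \<Rightarrow> real) \<Rightarrow> bool" where
  "riemannian_metric \<A> g \<longleftrightarrow> symmetric_two_tensor \<A> g \<and>
     (\<forall>c\<in>\<A>. \<forall>p\<in>cdom c. \<forall>u. u \<noteq> 0 \<longrightarrow> g c p u u > 0)"

text \<open>Both sign conventions are admitted: mostly minus (\<open>\<sigma> = 1\<close>) and mostly plus (\<open>\<sigma> = -1\<close>).\<close>

definition lorentzian_metric ::
  "('p, real ^ 'm) chart set \<Rightarrow> (('p, real ^ 'm) chart \<Rightarrow> 'p \<Rightarrow> real ^ 'm \<Rightarrow> real ^ 'm \<Rightarrow> real) \<Rightarrow> bool" where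
  "lorentzian_metric \<A> g \<longleftrightarrow> symmetric_two_tensor \<A> g \<and>
     (\<exists>\<sigma>\<in>{1, -1}. \<forall>c\<in>\<A>. \<forall>p\<in>cdom c. \<exists>(b :: 'm \<Rightarrow> real ^ 'm) \<tau>. \<forall>\<mu> \<nu>.
        g c p (b \<mu>) (b \<nu>) = (if \<mu> \<noteq> \<nu> then 0 else if \<mu> = \<tau> then \<sigma> else - \<sigma>))"

text \<open>The matrix \<open>g\<^sup>\<mu>\<^sup>\<nu>\<close> that raises indices.\<close>

definition inverse_metric ::
  "(('p, real ^ 'm) chart \<Rightarrow> 'p \<Rightarrow> real ^ 'm \<Rightarrow> real ^ 'm \<Rightarrow> real) \<Rightarrow> ('p, real ^ 'm) chart \<Rightarrow> 'p \<Rightarrow> real ^ 'm ^ 'm" where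
  "inverse_metric g c p = matrix_inv (\<chi> \<mu> \<nu>. g c p (axis \<mu> 1) (axis \<nu> 1))"

definition partial_deriv ::
  "('p, real ^ 'm) chart \<Rightarrow> 'm \<Rightarrow> ('p \<Rightarrow> 'v::real_normed_vector) \<Rightarrow> 'p \<Rightarrow> 'v" where
  "partial_deriv c \<mu> f p = frechet_derivative (f \<circ> cinv c) (at (cmap c p)) (axis \<mu> 1)"

definition ext_deriv ::
  "(('p, real ^ 'm) chart \<Rightarrow> 'p \<Rightarrow> real ^ 'm \<Rightarrow> 'v::real_normed_vector) \<Rightarrow>
   ('p, real ^ 'm) chart \<Rightarrow> 'm \<Rightarrow> 'm \<Rightarrow> 'p \<Rightarrow> 'v" where
  "ext_deriv A c \<mu> \<nu> p =
     partial_deriv c \<mu> (\<lambda>q. A c q (axis \<nu> 1)) p - partial_deriv c \<nu> (\<lambda>q. A c q (axis \<mu> 1)) p"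

text \<open>\<open>a\<^sup>\<mu> a\<^sub>\<mu>\<close> and \<open>T\<^sup>\<mu>\<^sup>\<nu> T\<^sub>\<mu>\<^sub>\<nu>\<close>.\<close>

definition square1 :: "real ^ 'm ^ 'm \<Rightarrow> ('m \<Rightarrow> real) \<Rightarrow> real" where
  "square1 h a = (\<Sum>\<mu>\<in>UNIV. (\<Sum>\<nu>\<in>UNIV. h $ \<mu> $ \<nu> * a \<nu>) * a \<mu>)"

definition square2 :: "real ^ 'm ^ 'm \<Rightarrow> ('m \<Rightarrow> 'm \<Rightarrow> real) \<Rightarrow> real" where
  "square2 h T = (\<Sum>\<mu>\<in>UNIV. \<Sum>\<nu>\<in>UNIV.
     (\<Sum>\<rho>\<in>UNIV. \<Sum>\<sigma>\<in>UNIV. h $ \<mu> $ \<rho> * h $ \<nu> $ \<sigma> * T \<rho> \<sigma>) * T \<mu> \<nu>)"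

section \<open>Lie groups and their Lie algebras\<close>

definition lie_group ::
  "('a::{t2_space, second_countable_topology}, 'g::real_normed_vector) chart set \<Rightarrow>
   ('a \<Rightarrow> 'a \<Rightarrow> 'a) \<Rightarrow> 'a \<Rightarrow> ('a \<Rightarrow> 'a) \<Rightarrow> bool" where
  "lie_group \<G> mul one ginv \<longleftrightarrow> smooth_atlas \<G> \<and> group mul one ginv \<and>
     smooth_map (prod_atlas \<G> \<G>) \<G> (\<lambda>(x, y). mul x y) \<and> smooth_map \<G> \<G> ginv"

text \<open>The Lie algebra is the tangent space at the neutral element. Throughout, \<open>c\<close> is a chart around
  the neutral element, whose differential identifies the Lie algebra with the model space \<open>'g\<close>.
  The bracket is the commutator, at the neutral element, of left invariant vector fields.\<close>

definition left_invariant_field ::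
  "('a, 'g::real_normed_vector) chart \<Rightarrow> ('a \<Rightarrow> 'a \<Rightarrow> 'a) \<Rightarrow> 'a \<Rightarrow> 'g \<Rightarrow> 'g \<Rightarrow> 'g" where
  "left_invariant_field c mul one X x =
     frechet_derivative (cmap c \<circ> mul (cinv c x) \<circ> cinv c) (at (cmap c one)) X"

definition lie_bracket ::
  "('a, 'g::real_normed_vector) chart \<Rightarrow> ('a \<Rightarrow> 'a \<Rightarrow> 'a) \<Rightarrow> 'a \<Rightarrow> 'g \<Rightarrow> 'g \<Rightarrow> 'g" where
  "lie_bracket c mul one X Y =
     frechet_derivative (left_invariant_field c mul one Y) (at (cmap c one)) X -
     frechet_derivative (left_invariant_field c mul one X) (at (cmap c one)) Y"

definition Ad ::
  "('a, 'g::real_normed_vector) chart \<Rightarrow> ('a \<Rightarrow> 'a \<Rightarrow> 'a) \<Rightarrow> 'a \<Rightarrow> ('a \<Rightarrow> 'a) \<Rightarrow> 'a \<Rightarrow> 'g \<Rightarrow> 'g" where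
  "Ad c mul one ginv a =
     frechet_derivative (cmap c \<circ> (\<lambda>b. mul (mul a b) (ginv a)) \<circ> cinv c) (at (cmap c one))"

definition scalar_product :: "('v::real_vector \<Rightarrow> 'v \<Rightarrow> real) \<Rightarrow> bool" where
  "scalar_product k \<longleftrightarrow> bilinear k \<and> (\<forall>x y. k x y = k y x) \<and> (\<forall>x. x \<noteq> 0 \<longrightarrow> k x x > 0)"

definition orthonormal_basis ::
  "('v::real_vector \<Rightarrow> 'v \<Rightarrow> real) \<Rightarrow> (nat \<Rightarrow> 'v) \<Rightarrow> nat set \<Rightarrow> 'v set \<Rightarrow> bool" where
  "orthonormal_basis k b I W \<longleftrightarrow> span (b ` I) = W \<and>
     (\<forall>i\<in>I. \<forall>j\<in>I. k (b i) (b j) = (if i = j then 1 else 0))"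

definition ortho_complement :: "('v \<Rightarrow> 'v \<Rightarrow> real) \<Rightarrow> 'v set \<Rightarrow> 'v set" where
  "ortho_complement k S = {x. \<forall>y\<in>S. k x y = 0}"

text \<open>The coefficient \<open>X\<^sup>i\<close> in \<open>X = (\<Sum>i = 1..r. X\<^sup>i \<alpha>\<^sub>i)\<close>.\<close>

definition lie_coeff :: "(nat \<Rightarrow> 'g::real_vector) \<Rightarrow> nat \<Rightarrow> nat \<Rightarrow> 'g \<Rightarrow> real" where
  "lie_coeff \<alpha> r i X = representation (\<alpha> ` {1..r}) X (\<alpha> i)"

section \<open>Unitary representations and the Higgs vacuum\<close>

definition hdot :: "complex ^ 'n \<Rightarrow> complex ^ 'n \<Rightarrow> complex" where
  "hdot v w = (\<Sum>i\<in>UNIV. cnj (v $ i) * w $ i)"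

text \<open>The real scalar product on \<open>complex ^ 'n\<close> is the library's inner product.\<close>

lemma inner_eq_Re_hdot: "v \<bullet> w = Re (hdot v w)"
  by (simp add: hdot_def inner_vec_def inner_complex_def)

definition unitary_rep ::
  "('a::{t2_space, second_countable_topology}, 'g::real_normed_vector) chart set \<Rightarrow>
   ('a \<Rightarrow> 'a \<Rightarrow> 'a) \<Rightarrow> 'a \<Rightarrow> ('a \<Rightarrow> complex ^ 'n ^ 'n) \<Rightarrow> bool" where
  "unitary_rep \<G> mul one \<rho> \<longleftrightarrow> smooth_map \<G> vector_space_atlas \<rho> \<and>
     \<rho> one = mat 1 \<and> (\<forall>a b. \<rho> (mul a b) = \<rho> a ** \<rho> b) \<and>
     (\<forall>a v w. hdot (\<rho> a *v v) (\<rho> a *v w) = hdot v w)"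

definition lie_action ::
  "('a, 'g::real_normed_vector) chart \<Rightarrow> 'a \<Rightarrow> ('a \<Rightarrow> complex ^ 'n ^ 'n) \<Rightarrow> 'g \<Rightarrow> complex ^ 'n \<Rightarrow> complex ^ 'n" where
  "lie_action c one \<rho> X v = frechet_derivative (\<lambda>x. \<rho> (cinv c x) *v v) (at (cmap c one)) X"

definition stabilizer :: "('a \<Rightarrow> complex ^ 'n ^ 'n) \<Rightarrow> complex ^ 'n \<Rightarrow> 'a set" where
  "stabilizer \<rho> v = {a. \<rho> a *v v = v}"

definition orbit :: "('a \<Rightarrow> complex ^ 'n ^ 'n) \<Rightarrow> complex ^ 'n \<Rightarrow> (complex ^ 'n) set" where
  "orbit \<rho> v = range (\<lambda>a. \<rho> a *v v)"

definition stabilizer_algebra ::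
  "('a, 'g::real_normed_vector) chart \<Rightarrow> 'a \<Rightarrow> ('a \<Rightarrow> complex ^ 'n ^ 'n) \<Rightarrow> complex ^ 'n \<Rightarrow> 'g set" where
  "stabilizer_algebra c one \<rho> v = tangent_space_in c (stabilizer \<rho> v) one"

definition orbit_tangent :: "('a \<Rightarrow> complex ^ 'n ^ 'n) \<Rightarrow> complex ^ 'n \<Rightarrow> (complex ^ 'n) set" where
  "orbit_tangent \<rho> v = tangent_space_in (UNIV, id) (orbit \<rho> v) v"

definition mass_form ::
  "('a, 'g::real_normed_vector) chart \<Rightarrow> 'a \<Rightarrow> ('a \<Rightarrow> complex ^ 'n ^ 'n) \<Rightarrow> complex ^ 'n \<Rightarrow> 'g \<Rightarrow> 'g \<Rightarrow> real" where
  "mass_form c one \<rho> v X Y = lie_action c one \<rho> X v \<bullet> lie_action c one \<rho> Y v"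

text \<open>The Hessian as the linear map corresponding, via the scalar product, to the bilinear form
  given by the second derivative.\<close>

definition hessian :: "('e::euclidean_space \<Rightarrow> real) \<Rightarrow> 'e \<Rightarrow> 'e \<Rightarrow> 'e" where
  "hessian V v u = (\<Sum>b\<in>Basis.
     frechet_derivative (\<lambda>x. frechet_derivative V (at x) b) (at v) u *\<^sub>R b)"

section \<open>The Lagrangians\<close>

definition cov_deriv ::
  "('a, 'g::real_normed_vector) chart \<Rightarrow> 'a \<Rightarrow> ('a \<Rightarrow> complex ^ 'n ^ 'n) \<Rightarrow>
   (('p, real ^ 'm) chart \<Rightarrow> 'p \<Rightarrow> real ^ 'm \<Rightarrow> 'g) \<Rightarrow> ('p \<Rightarrow> complex ^ 'n) \<Rightarrow>
   ('p, real ^ 'm) chart \<Rightarrow> 'm \<Rightarrow> 'p \<Rightarrow> complex ^ 'n" where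
  "cov_deriv cG one \<rho> A \<Phi> c \<mu> p =
     partial_deriv c \<mu> \<Phi> p + lie_action cG one \<rho> (A c p (axis \<mu> 1)) (\<Phi> p)"

definition field_strength ::
  "('a, 'g::real_normed_vector) chart \<Rightarrow> ('a \<Rightarrow> 'a \<Rightarrow> 'a) \<Rightarrow> 'a \<Rightarrow>
   (('p, real ^ 'm) chart \<Rightarrow> 'p \<Rightarrow> real ^ 'm \<Rightarrow> 'g) \<Rightarrow> ('p, real ^ 'm) chart \<Rightarrow> 'm \<Rightarrow> 'm \<Rightarrow> 'p \<Rightarrow> 'g" where
  "field_strength cG mul one A c \<mu> \<nu> p =
     ext_deriv A c \<mu> \<nu> p + lie_bracket cG mul one (A c p (axis \<mu> 1)) (A c p (axis \<nu> 1))"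

text \<open>The Yang-Mills-Higgs Lagrangian at \<open>p\<close>, computed in the chart \<open>c\<close>. It is complex valued since
  its kinetic term is written with the Hermitian product.\<close>

definition ymh_lagrangian ::
  "(('p, real ^ 'm) chart \<Rightarrow> 'p \<Rightarrow> real ^ 'm \<Rightarrow> real ^ 'm \<Rightarrow> real) \<Rightarrow>
   ('a, 'g::real_normed_vector) chart \<Rightarrow> ('a \<Rightarrow> 'a \<Rightarrow> 'a) \<Rightarrow> 'a \<Rightarrow>
   ('a \<Rightarrow> complex ^ 'n ^ 'n) \<Rightarrow> (complex ^ 'n \<Rightarrow> real) \<Rightarrow> (nat \<Rightarrow> 'g) \<Rightarrow> nat \<Rightarrow>
   ('p \<Rightarrow> complex ^ 'n) \<Rightarrow> (('p, real ^ 'm) chart \<Rightarrow> 'p \<Rightarrow> real ^ 'm \<Rightarrow> 'g) \<Rightarrow>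
   ('p, real ^ 'm) chart \<Rightarrow> 'p \<Rightarrow> complex" where
  "ymh_lagrangian g cG mul one \<rho> V \<alpha> r \<Phi> A c p =
     (\<Sum>\<mu>\<in>UNIV. hdot (\<Sum>\<nu>\<in>UNIV. inverse_metric g c p $ \<mu> $ \<nu> *\<^sub>R cov_deriv cG one \<rho> A \<Phi> c \<nu> p)
                     (cov_deriv cG one \<rho> A \<Phi> c \<mu> p))
     - complex_of_real (V (\<Phi> p))
     - complex_of_real (1/4 * (\<Sum>i=1..r. square2 (inverse_metric g c p)
         (\<lambda>\<mu> \<nu>. lie_coeff \<alpha> r i (field_strength cG mul one A c \<mu> \<nu> p))))"

definition broken_lagrangian ::
  "(('p, real ^ 'm) chart \<Rightarrow> 'p \<Rightarrow> real ^ 'm \<Rightarrow> real ^ 'm \<Rightarrow> real) \<Rightarrow>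
   (nat \<Rightarrow> 'g::real_normed_vector) \<Rightarrow> nat \<Rightarrow> nat \<Rightarrow> nat \<Rightarrow> (nat \<Rightarrow> real) \<Rightarrow> (nat \<Rightarrow> real) \<Rightarrow>
   (nat \<Rightarrow> 'p \<Rightarrow> real) \<Rightarrow> (('p, real ^ 'm) chart \<Rightarrow> 'p \<Rightarrow> real ^ 'm \<Rightarrow> 'g) \<Rightarrow>
   ('p, real ^ 'm) chart \<Rightarrow> 'p \<Rightarrow> real" where
  "broken_lagrangian g \<alpha> r d N mf M \<eta> A c p =
     (let h = inverse_metric g c p; Ai = (\<lambda>i c q u. lie_coeff \<alpha> r i (A c q u)) in
       1/2 * (\<Sum>j=1..N. square1 h (\<lambda>\<mu>. partial_deriv c \<mu> (\<eta> j) p))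
     - 1/2 * (\<Sum>j=1..N. (mf j)\<^sup>2 * (\<eta> j p)\<^sup>2)
     - 1/4 * (\<Sum>i=1..d. square2 h (\<lambda>\<mu> \<nu>. ext_deriv (Ai i) c \<mu> \<nu> p))
     + 1/2 * (\<Sum>i=1..d. (M i)\<^sup>2 * square1 h (\<lambda>\<mu>. Ai i c p (axis \<mu> 1)))
     - 1/4 * (\<Sum>i=d+1..r. square2 h (\<lambda>\<mu> \<nu>. ext_deriv (Ai i) c \<mu> \<nu> p)))"

text \<open>\<open>f\<close> has the Taylor coefficients \<open>a\<^sub>0, a\<^sub>1, a\<^sub>2\<close> of orders 0, 1, 2 at 0.\<close>

definition taylor2 :: "(real \<Rightarrow> 'v::real_normed_vector) \<Rightarrow> 'v \<Rightarrow> 'v \<Rightarrow> 'v \<Rightarrow> bool" where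
  "taylor2 f a\<^sub>0 a\<^sub>1 a\<^sub>2 \<longleftrightarrow> f 0 = a\<^sub>0 \<and>
     (\<exists>f'. (\<forall>\<^sub>F t in nhds 0. (f has_vector_derivative f' t) (at t)) \<and> f' 0 = a\<^sub>1 \<and>
           (f' has_vector_derivative 2 *\<^sub>R a\<^sub>2) (at 0))"

definition agree_to_second_order ::
  "(real \<Rightarrow> 'v::real_normed_vector) \<Rightarrow> (real \<Rightarrow> 'v) \<Rightarrow> bool" where
  "agree_to_second_order f h \<longleftrightarrow> (\<exists>a\<^sub>0 a\<^sub>1 a\<^sub>2. taylor2 f a\<^sub>0 a\<^sub>1 a\<^sub>2 \<and> taylor2 h a\<^sub>0 a\<^sub>1 a\<^sub>2)"

end

theory Submission
  imports Defs
begin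

text \<open>After the rescaling by \<open>t\<close> the covariant derivative is \<open>t w + t\<^sup>2 z\<close> with
  \<open>w\<^sub>\<mu> = \<partial>\<^sub>\<mu> \<Phi> + A\<^sub>\<mu> v\<^sub>0\<close>, and the field strength is \<open>t dA + t\<^sup>2 [A, A]\<close>, so the kinetic
  and Yang-Mills terms are quartic polynomials in \<open>t\<close> that start with the squares of \<open>w\<close> and \<open>dA\<close>.
  In unitary gauge \<open>\<partial>\<^sub>\<mu> \<Phi>\<close> takes values in the span of the \<open>f\<^sub>j\<close>, which is orthogonal to the orbit
  directions \<open>A\<^sub>\<mu> v\<^sub>0\<close>; hence the square of \<open>w\<close> has no mixed terms, and its gauge part is the
  diagonal mass form, which vanishes on the stabilizer algebra. The potential contributes its Hessian
  at the minimum \<open>v\<^sub>0\<close>, diagonal in the \<open>f\<^sub>j\<close>.\<close>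

section \<open>Smooth maps, second order Taylor expansions and the metric\<close>

lemma frechet_derivative_eq: "(f has_derivative f') (at x) \<Longrightarrow> frechet_derivative f (at x) = f'"
  using frechet_derivative_at by metis

lemma smooth_on_has_derivative:
  assumes "smooth_on S f" "x \<in> S"
  shows "(f has_derivative frechet_derivative f (at x)) (at x)"
proof -
  have "Ck_on (Suc 0) S f" using assms(1) unfolding smooth_on_def by blast
  then show ?thesis using assms(2) by (simp add: frechet_derivative_works)
qed

lemma smooth_on_frechet_derivative:
  assumes "smooth_on S f"
  shows "smooth_on S (\<lambda>x. frechet_derivative f (at x) v)"
  unfolding smooth_on_def
proof
  fix k
  have "Ck_on (Suc k) S f" using assms unfolding smooth_on_def by blast
  then show "Ck_on k S (\<lambda>x. frechet_derivative f (at x) v)" by simp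
qed

text \<open>Openness of \<open>S\<close> lets agreement on \<open>S\<close> pass to the derivatives,
  so the induction can continue with every directional derivative.\<close>

lemma Ck_on_cong:
  assumes "open S" "\<And>x. x \<in> S \<Longrightarrow> f x = g x" "Ck_on k S f"
  shows "Ck_on k S g"
  using assms(2,3)
proof (induction k arbitrary: f g)
  case 0
  then show ?case using continuous_on_cong[of S S f g] by simp
next
  case (Suc k)
  have der: "(g has_derivative frechet_derivative f (at x)) (at x)" if "x \<in> S" for x
  proof (rule has_derivative_transform_within_open)
    show "(f has_derivative frechet_derivative f (at x)) (at x)"
      using Suc.prems(2) that by (simp add: frechet_derivative_works)
  qed (use assms(1) that Suc.prems(1) in auto)
  have "Ck_on k S (\<lambda>x. frechet_derivative g (at x) v)" for v
  proof (rule Suc.IH)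
    show "Ck_on k S (\<lambda>x. frechet_derivative f (at x) v)" using Suc.prems(2) by simp
    show "frechet_derivative f (at x) v = frechet_derivative g (at x) v" if "x \<in> S" for x
      by (simp add: frechet_derivative_eq[OF der[OF that]])
  qed
  then show ?case using der differentiable_def by (simp; blast)
qed

text \<open>A bounded linear map commutes with differentiation, so each derivative has the same form
  again. It serves to evaluate a smooth family of matrices at a fixed vector.\<close>

lemma Ck_on_bounded_linear_compose:
  assumes "open S" "bounded_linear L" "Ck_on k S f"
  shows "Ck_on k S (\<lambda>x. L (f x))"
  using assms(3)
proof (induction k arbitrary: f)
  case 0
  then show ?case using bounded_linear.continuous_on[OF assms(2)] by auto
next
  case (Suc k)
  have der: "((\<lambda>x. L (f x)) has_derivative (\<lambda>v. L (frechet_derivative f (at x) v))) (at x)"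
    if "x \<in> S" for x
    using Suc.prems that
    by (intro bounded_linear.has_derivative[OF assms(2)]) (simp add: frechet_derivative_works)
  have "Ck_on k S (\<lambda>x. frechet_derivative (\<lambda>x. L (f x)) (at x) v)" for v
  proof (rule Ck_on_cong[OF assms(1)])
    show "Ck_on k S (\<lambda>x. L (frechet_derivative f (at x) v))"
      using Suc.prems by (intro Suc.IH) simp
  qed (simp add: frechet_derivative_eq[OF der])
  then show ?case using der differentiable_def by (simp; blast)
qed

text \<open>By the chain rule the derivative along the line is a directional derivative of
  \<open>f\<close> in a fixed multiple of \<open>X\<close>, again restricted to the line; hence the
  induction generalizes over \<open>f\<close>.\<close>

lemma Ck_on_line:
  fixes I :: "real set"
  assumes "open I" "\<And>t. t \<in> I \<Longrightarrow> a + t *\<^sub>R X \<in> S" "Ck_on k S f"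
  shows "Ck_on k I (\<lambda>t. f (a + t *\<^sub>R X))"
  using assms(3)
proof (induction k arbitrary: f)
  case 0
  then have "continuous_on S f" by simp
  then show ?case using assms(2)
    by (auto intro!: continuous_on_compose2[of S f] continuous_intros)
next
  case (Suc k)
  have der: "((\<lambda>t. f (a + t *\<^sub>R X)) has_derivative
      (\<lambda>v. frechet_derivative f (at (a + t *\<^sub>R X)) (v *\<^sub>R X))) (at t)" if "t \<in> I" for t
  proof (rule has_derivative_compose[of _ "\<lambda>v. v *\<^sub>R X"])
    show "((\<lambda>t. a + t *\<^sub>R X) has_derivative (\<lambda>v. v *\<^sub>R X)) (at t)"
      by (auto intro!: derivative_eq_intros)
    show "(f has_derivative frechet_derivative f (at (a + t *\<^sub>R X))) (at (a + t *\<^sub>R X))"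
      using Suc.prems assms(2)[OF that] by (simp add: frechet_derivative_works)
  qed
  have "Ck_on k I (\<lambda>t. frechet_derivative (\<lambda>t. f (a + t *\<^sub>R X)) (at t) v)" for v
  proof (rule Ck_on_cong[OF assms(1)])
    show "Ck_on k I (\<lambda>t. frechet_derivative f (at (a + t *\<^sub>R X)) (v *\<^sub>R X))"
      using Suc.prems by (intro Suc.IH[of "\<lambda>x. frechet_derivative f (at x) (v *\<^sub>R X)"]) simp
  qed (simp add: frechet_derivative_eq[OF der])
  then show ?case using der differentiable_def by (simp; blast)
qed

text \<open>The Lie algebra is only known to be a finite-dimensional \<^class>\<open>real_inner\<close> space, so
  \<open>linear_conv_bounded_linear\<close> does not apply.\<close>

lemma linear_imp_bounded_linear_finite_span:
  fixes L :: "'a::real_inner \<Rightarrow> 'b::real_normed_vector" and B :: "'a set"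
  assumes "finite B" "span B = UNIV" "linear L"
  shows "bounded_linear L"
proof -
  obtain C :: "'a set" where C: "finite C" "span C = UNIV" "pairwise orthogonal C"
    using basis_orthogonal[OF assms(1)] assms(2) by auto
  \<comment> \<open>The expansion uses an orthogonal set that is not normalized. Should
    \<open>C\<close> contain 0, its term is zero and the division by zero does no harm. The
    remainder is orthogonal to the span of \<open>C\<close>, hence to itself.\<close>
  have repr: "x = (\<Sum>b\<in>C. (b \<bullet> x / (b \<bullet> b)) *\<^sub>R b)" for x
  proof -
    let ?y = "x - (\<Sum>b\<in>C. (b \<bullet> x / (b \<bullet> b)) *\<^sub>R b)"
    have "orthogonal ?y b" if "b \<in> C" for b
    proof -
      have "(\<Sum>c\<in>C. c \<bullet> x / (c \<bullet> c) * (c \<bullet> b)) = (\<Sum>c\<in>C. if c = b then b \<bullet> x else 0)"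
        using C(3) that by (intro sum.cong) (auto simp: pairwise_def orthogonal_def)
      then show ?thesis
        using C(1) that
        by (simp add: orthogonal_def inner_diff_left inner_sum_left inner_commute[of b x])
    qed
    then have "orthogonal ?y ?y"
      using C(2) by (intro orthogonal_to_span[of ?y C]) auto
    then show ?thesis by (simp add: orthogonal_self)
  qed
  \<comment> \<open>In these coordinates \<open>L\<close> is a finite sum of continuous functionals
    times fixed vectors.\<close>
  have "L = (\<lambda>x. \<Sum>b\<in>C. (b \<bullet> x / (b \<bullet> b)) *\<^sub>R L b)"
  proof
    fix x
    show "L x = (\<Sum>b\<in>C. (b \<bullet> x / (b \<bullet> b)) *\<^sub>R L b)"
      by (subst (1) repr) (simp add: linear_sum[OF assms(3)] linear_scale[OF assms(3)])
  qed
  moreover have "bounded_linear (\<lambda>x. \<Sum>b\<in>C. (b \<bullet> x / (b \<bullet> b)) *\<^sub>R L b)"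
    by (intro bounded_linear_sum bounded_linear_scaleR_left[THEN bounded_linear_compose]
        bounded_linear_divide[THEN bounded_linear_compose] bounded_linear_inner_right)
  ultimately show ?thesis by simp
qed

section \<open>Calculus of second order Taylor coefficients\<close>

lemma taylor2_const: "taylor2 (\<lambda>t. c) c 0 0"
  unfolding taylor2_def by (auto intro!: exI[of _ "\<lambda>t. 0"])

lemma taylor2_add:
  assumes "taylor2 f a b c" "taylor2 g a' b' c'"
  shows "taylor2 (\<lambda>t. f t + g t) (a + a') (b + b') (c + c')"
proof -
  obtain f' where f: "\<forall>\<^sub>F t in nhds 0. (f has_vector_derivative f' t) (at t)" "f' 0 = b"
    "(f' has_vector_derivative 2 *\<^sub>R c) (at 0)" "f 0 = a"
    using assms(1) unfolding taylor2_def by blast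
  obtain g' where g: "\<forall>\<^sub>F t in nhds 0. (g has_vector_derivative g' t) (at t)" "g' 0 = b'"
    "(g' has_vector_derivative 2 *\<^sub>R c') (at 0)" "g 0 = a'"
    using assms(2) unfolding taylor2_def by blast
  have "\<forall>\<^sub>F t in nhds 0. ((\<lambda>t. f t + g t) has_vector_derivative (f' t + g' t)) (at t)"
    using f(1) g(1) by eventually_elim (rule has_vector_derivative_add)
  moreover have "((\<lambda>t. f' t + g' t) has_vector_derivative 2 *\<^sub>R (c + c')) (at 0)"
    using has_vector_derivative_add[OF f(3) g(3)] by (simp add: scaleR_add_right)
  ultimately show ?thesis unfolding taylor2_def using f g by (auto intro!: exI[of _ "\<lambda>t. f' t + g' t"])
qed

lemma taylor2_bounded_linear:
  assumes "bounded_linear L" "taylor2 f a b c"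
  shows "taylor2 (\<lambda>t. L (f t)) (L a) (L b) (L c)"
proof -
  obtain f' where f: "\<forall>\<^sub>F t in nhds 0. (f has_vector_derivative f' t) (at t)" "f' 0 = b"
    "(f' has_vector_derivative 2 *\<^sub>R c) (at 0)" "f 0 = a"
    using assms(2) unfolding taylor2_def by blast
  have "\<forall>\<^sub>F t in nhds 0. ((\<lambda>t. L (f t)) has_vector_derivative L (f' t)) (at t)"
    using f(1) by eventually_elim (rule bounded_linear.has_vector_derivative[OF assms(1)])
  moreover have "((\<lambda>t. L (f' t)) has_vector_derivative 2 *\<^sub>R L c) (at 0)"
    using bounded_linear.has_vector_derivative[OF assms(1) f(3)]
      linear_scale[OF bounded_linear.linear[OF assms(1)]] by simp
  ultimately show ?thesis unfolding taylor2_def using f by (auto intro!: exI[of _ "\<lambda>t. L (f' t)"])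
qed

text \<open>The kinetic and gauge terms are brought to this shape; their interaction parts sit in
  \<open>b\<close> and \<open>c\<close> and leave the three coefficients untouched.\<close>

lemma taylor2_quartic: "taylor2 (\<lambda>t. t^2 *\<^sub>R a + t^3 *\<^sub>R b + t^4 *\<^sub>R c) 0 0 a"
proof -
  have "((\<lambda>t. t^2 *\<^sub>R a + t^3 *\<^sub>R b + t^4 *\<^sub>R c) has_vector_derivative
      ((2 * t) *\<^sub>R a + (3 * t^2) *\<^sub>R b + (4 * t^3) *\<^sub>R c)) (at t)" for t :: real
    by (auto intro!: derivative_eq_intros simp: has_real_derivative_iff_has_vector_derivative[symmetric])
  moreover have "((\<lambda>t. (2 * t) *\<^sub>R a + (3 * t^2) *\<^sub>R b + (4 * t^3) *\<^sub>R c) has_vector_derivative 2 *\<^sub>R a)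
      (at (0::real))"
    by (auto intro!: derivative_eq_intros simp: has_real_derivative_iff_has_vector_derivative[symmetric])
  ultimately show ?thesis unfolding taylor2_def
    by (auto intro!: exI[of _ "\<lambda>t. (2 * t) *\<^sub>R a + (3 * t^2) *\<^sub>R b + (4 * t^3) *\<^sub>R c"])
qed

text \<open>The derivative vanishes at a local minimum, which removes the first order.
  Differentiating once more along the line gives the Hessian form; the factor 1/2 answers the 2 that
  \<open>taylor2\<close> attaches to its last coefficient.\<close>

lemma taylor2_local_minimum:
  fixes V :: "'e::euclidean_space \<Rightarrow> real"
  assumes "smooth_on UNIV V" "\<forall>\<^sub>F v in nhds v0. V v0 \<le> V v"
  shows "taylor2 (\<lambda>t. V (v0 + t *\<^sub>R u)) (V v0) 0 (1/2 * (u \<bullet> hessian V v0 u))"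
proof -
  let ?D = "\<lambda>x. frechet_derivative V (at x)"
  have D: "(V has_derivative ?D x) (at x)" for x
    using smooth_on_has_derivative[OF assms(1)] by simp
  have line: "((\<lambda>t. v0 + t *\<^sub>R u) has_derivative (\<lambda>s. s *\<^sub>R u)) (at t)" for t :: real
    by (auto intro!: derivative_eq_intros)
  have along: "((\<lambda>t. F (v0 + t *\<^sub>R u)) has_vector_derivative frechet_derivative F (at (v0 + t *\<^sub>R u)) u) (at t)"
    if "smooth_on UNIV F" for F :: "'e \<Rightarrow> real" and t :: real
  proof -
    have F: "(F has_derivative frechet_derivative F (at (v0 + t *\<^sub>R u))) (at (v0 + t *\<^sub>R u))"
      using smooth_on_has_derivative[OF that] by simp
    show ?thesis
      using has_derivative_compose[OF line F] linear_scale[OF has_derivative_linear[OF F]]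
      by (simp add: has_vector_derivative_def)
  qed
  have "?D v0 = (\<lambda>v. 0)"
  proof -
    obtain S where "open S" "v0 \<in> S" "\<forall>v\<in>S. V v0 \<le> V v"
      using assms(2) unfolding eventually_nhds by blast
    then show ?thesis using differential_zero_maxmin[OF _ _ D] by blast
  qed
  moreover have "((\<lambda>t. ?D (v0 + t *\<^sub>R u) u) has_vector_derivative u \<bullet> hessian V v0 u) (at 0)"
  proof -
    \<comment> \<open>\<open>hessian\<close> differentiates the derivatives in basis directions, so
      \<open>u\<close> is decomposed before the second differentiation.\<close>
    have expand: "?D x u = (\<Sum>b\<in>Basis. (u \<bullet> b) * ?D x b)" for x
      by (subst (1) euclidean_representation[symmetric])
        (simp only: linear_sum[OF has_derivative_linear[OF D]]
          linear_scale[OF has_derivative_linear[OF D]] real_scaleR_def)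
    have "((\<lambda>t. ?D (v0 + t *\<^sub>R u) b) has_vector_derivative
        frechet_derivative (\<lambda>x. ?D x b) (at v0) u) (at 0)" for b
      using along[OF smooth_on_frechet_derivative[OF assms(1)], of b 0] by simp
    then have "((\<lambda>t. \<Sum>b\<in>Basis. (u \<bullet> b) * ?D (v0 + t *\<^sub>R u) b) has_vector_derivative
        (\<Sum>b\<in>Basis. (u \<bullet> b) * frechet_derivative (\<lambda>x. ?D x b) (at v0) u)) (at 0)"
      by (intro has_vector_derivative_sum) (rule has_vector_derivative_mult_right)
    then show ?thesis by (simp add: expand[abs_def] hessian_def inner_sum_right mult.commute)
  qed
  ultimately show ?thesis unfolding taylor2_def using along[OF assms(1)]
    by (auto intro!: exI[of _ "\<lambda>t. ?D (v0 + t *\<^sub>R u) u"])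
qed

text \<open>A \<open>frechet_derivative\<close> is known to be linear only where the map is
  differentiable; smoothness of \<open>V\<close> secures this for each of its directional
  derivatives.\<close>

lemma linear_hessian:
  fixes V :: "'e::euclidean_space \<Rightarrow> real"
  assumes "smooth_on UNIV V"
  shows "linear (hessian V v)"
proof -
  have "linear (frechet_derivative (\<lambda>x. frechet_derivative V (at x) b) (at v))" for b
    using smooth_on_has_derivative[OF smooth_on_frechet_derivative[OF assms]] has_derivative_linear
    by blast
  then show ?thesis
    unfolding hessian_def[abs_def]
    by (intro linear_compose_sum ballI) (auto simp: linear_iff scaleR_add_left)
qed

text \<open>\<open>matrix_inv\<close> says something only about an invertible matrix, so
  nondegeneracy comes first: positivity makes the kernel trivial, and a Lorentzian frame produces an
  inverse. The transpose of the inverse is then also an inverse of the symmetric \<open>G\<close>,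
  and inverses are unique.\<close>

lemma inverse_metric_symmetric:
  fixes g :: "('p, real ^ 'm) chart \<Rightarrow> 'p \<Rightarrow> real ^ 'm \<Rightarrow> real ^ 'm \<Rightarrow> real"
  assumes "riemannian_metric \<A> g \<or> lorentzian_metric \<A> g" "c \<in> \<A>" "p \<in> cdom c"
  shows "inverse_metric g c p $ \<mu> $ \<nu> = inverse_metric g c p $ \<nu> $ \<mu>"
proof -
  define G :: "real ^ 'm ^ 'm" where "G = (\<chi> \<mu> \<nu>. g c p (axis \<mu> 1) (axis \<nu> 1))"
  have "symmetric_two_tensor \<A> g"
    using assms(1) unfolding riemannian_metric_def lorentzian_metric_def by blast
  then have bil: "bilinear (g c p)" and sym: "g c p u v = g c p v u" for u v
    using assms(2,3) unfolding symmetric_two_tensor_def by blast+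
  have expand: "g c p u v = u \<bullet> (G *v v)" for u v
  proof -
    have l: "linear (\<lambda>u. g c p u v)" and r: "linear (g c p u)" for u v
      using bil unfolding bilinear_def by blast+
    have coords: "(\<Sum>i\<in>UNIV. (w $ i) *\<^sub>R axis i 1) = w" for w :: "real ^ 'm"
      using basis_expansion[of w] by (simp add: scalar_mult_eq_scaleR)
    have "g c p u v = g c p (\<Sum>i\<in>UNIV. (u $ i) *\<^sub>R axis i 1) (\<Sum>j\<in>UNIV. (v $ j) *\<^sub>R axis j 1)"
      by (simp add: coords)
    also have "\<dots> = (\<Sum>i\<in>UNIV. u $ i * g c p (axis i 1) (\<Sum>j\<in>UNIV. (v $ j) *\<^sub>R axis j 1))"
      by (simp only: linear_sum[OF l] linear_scale[OF l] real_scaleR_def)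
    also have "\<dots> = (\<Sum>i\<in>UNIV. u $ i * (\<Sum>j\<in>UNIV. v $ j * G $ i $ j))"
      by (simp add: linear_sum[OF r] linear_scale[OF r] G_def)
    also have "\<dots> = u \<bullet> (G *v v)"
      by (simp add: inner_vec_def matrix_vector_mult_def mult.commute)
    finally show ?thesis .
  qed
  have "invertible G"
    using assms(1)
  proof
    assume "riemannian_metric \<A> g"
    then have pos: "u \<noteq> 0 \<Longrightarrow> g c p u u > 0" for u
      using assms(2,3) unfolding riemannian_metric_def by blast
    have "x = 0" if "G *v x = 0" for x
      using pos[of x] that by (cases "x = 0") (simp_all add: expand)
    then show ?thesis
      unfolding invertible_left_inverse matrix_left_invertible_ker by blast
  next
    assume "lorentzian_metric \<A> g"
    then obtain \<sigma> :: real and b :: "'m \<Rightarrow> real ^ 'm" and \<tau>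
      where \<sigma>: "\<sigma> \<in> {1, -1}" and b: "\<And>\<mu> \<nu>. g c p (b \<mu>) (b \<nu>) =
        (if \<mu> \<noteq> \<nu> then 0 else if \<mu> = \<tau> then \<sigma> else - \<sigma>)"
      using assms(2,3) unfolding lorentzian_metric_def by metis
    define B :: "real ^ 'm ^ 'm" where "B = (\<chi> \<mu>. b \<mu>)"
    define S :: "real ^ 'm ^ 'm" where "S = (\<chi> \<mu> \<nu>. g c p (b \<mu>) (b \<nu>))"
    \<comment> \<open>The Gram matrix \<open>S\<close> of the frame is diagonal with entries 1 or
      -1, hence its own inverse. This gives a right inverse of \<open>G\<close> without first
      showing that the frame is a basis.\<close>
    have "B ** (G ** transpose B) = S"
      unfolding vec_eq_iff
      by (auto simp: S_def expand B_def matrix_matrix_mult_def transpose_def inner_vec_def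
          matrix_vector_mult_def)
    moreover have "S ** S = mat 1"
    proof -
      have "S $ i $ k * S $ k $ j = (if k = i then mat 1 $ i $ j else 0)" for i j k
        using \<sigma> by (auto simp: S_def b mat_def)
      then show ?thesis by (simp add: vec_eq_iff matrix_matrix_mult_def)
    qed
    ultimately have "B ** (G ** transpose B ** S) = mat 1"
      by (metis matrix_mul_assoc)
    then have "G ** (transpose B ** S ** B) = mat 1"
      by (metis matrix_left_right_inverse matrix_mul_assoc)
    then show ?thesis unfolding invertible_right_inverse by blast
  qed
  then have inv: "G ** matrix_inv G = mat 1" "matrix_inv G ** G = mat 1"
    using someI_ex[of "\<lambda>B. G ** B = mat 1 \<and> B ** G = mat 1"]
    unfolding invertible_def matrix_inv_def by blast+
  have "transpose G = G"
    unfolding vec_eq_iff by (auto simp: G_def transpose_def sym)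
  then have "G ** transpose (matrix_inv G) = mat 1"
    using inv(2) by (metis matrix_transpose_mul transpose_mat)
  then have "transpose (matrix_inv G) = matrix_inv G"
    by (metis inv(2) matrix_mul_assoc matrix_mul_lid matrix_mul_rid)
  from arg_cong[OF this, of "\<lambda>H. H $ \<nu> $ \<mu>"] show ?thesis
    unfolding inverse_metric_def G_def[symmetric] by (simp add: transpose_def)
qed

section \<open>The infinitesimal action and the Lie bracket\<close>

text \<open>The affine form covers the rescaled Higgs field, the Higgs coordinates, the projection
  to the \<open>f j\<close>, and the coefficients of the gauge field.\<close>

lemma partial_deriv_bounded_linear:
  assumes "bounded_linear L" "(f \<circ> cinv c) differentiable (at (cmap c p))"
  shows "partial_deriv c \<mu> (\<lambda>q. a + L (f q)) p = L (partial_deriv c \<mu> f p)"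
proof -
  have "((\<lambda>x. a + L ((f \<circ> cinv c) x)) has_derivative
      (\<lambda>v. L (frechet_derivative (f \<circ> cinv c) (at (cmap c p)) v))) (at (cmap c p))"
    using bounded_linear.has_derivative[OF assms(1) assms(2)[unfolded frechet_derivative_works]]
    by (auto intro!: derivative_eq_intros)
  from frechet_derivative_eq[OF this] show ?thesis
    by (simp add: partial_deriv_def comp_def)
qed

lemma smooth_map_vector_space:
  assumes "smooth_map \<A> vector_space_atlas F" "c \<in> \<A>"
  shows "smooth_on (cimg c) (F \<circ> cinv c)"
  using assms unfolding smooth_map_def vector_space_atlas_def by auto

lemma bounded_linear_matrix_vector_mult_left:
  "bounded_linear (\<lambda>B. B *v (v :: complex ^ 'n) :: complex ^ 'n)"
  unfolding linear_conv_bounded_linear[symmetric]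
  by (auto simp: linear_iff vec_eq_iff matrix_vector_mult_def sum.distrib algebra_simps
      scaleR_sum_right)

lemma matrix_vector_mult_scaleR: "B *v (t *\<^sub>R v) = t *\<^sub>R (B *v v :: complex ^ 'n)"
  by (auto simp: vec_eq_iff matrix_vector_mult_def scaleR_sum_right)

section \<open>Infinitesimal action of the Lie algebra\<close>

context
  fixes \<G> :: "('a::{t2_space, second_countable_topology}, 'g::real_normed_vector) chart set"
    and mul :: "'a \<Rightarrow> 'a \<Rightarrow> 'a" and one :: 'a and cG :: "('a, 'g) chart"
    and \<rho> :: "'a \<Rightarrow> complex ^ 'n ^ 'n"
  assumes chart: "cG \<in> \<G>" "one \<in> cdom cG" "is_chart cG"
    and rep: "unitary_rep \<G> mul one \<rho>"
begin

lemma chart_inverse: "x \<in> cdom cG \<Longrightarrow> cinv cG (cmap cG x) = x"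
  using chart(3) unfolding is_chart_def homeomorphism_def by blast

lemma smooth_on_rep: "smooth_on (cimg cG) (\<rho> \<circ> cinv cG)"
  using smooth_map_vector_space[of \<G> \<rho> cG] rep chart(1) unfolding unitary_rep_def by blast

lemma rep_has_derivative:
  "((\<rho> \<circ> cinv cG) has_derivative frechet_derivative (\<rho> \<circ> cinv cG) (at (cmap cG one))) (at (cmap cG one))"
  using smooth_on_has_derivative[OF smooth_on_rep] chart(2) by blast

text \<open>Evaluation at \<open>v\<close> is bounded linear in the matrix and can leave the
  derivative. This exposes linearity in \<open>v\<close>, which the definition hides.\<close>

lemma lie_action_eq:
  "lie_action cG one \<rho> X v = frechet_derivative (\<rho> \<circ> cinv cG) (at (cmap cG one)) X *v v"
proof -
  have D: "((\<lambda>x. \<rho> (cinv cG x) *v v) has_derivative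
      (\<lambda>X. frechet_derivative (\<rho> \<circ> cinv cG) (at (cmap cG one)) X *v v)) (at (cmap cG one))"
    using bounded_linear.has_derivative[OF bounded_linear_matrix_vector_mult_left rep_has_derivative]
    by simp
  then show ?thesis by (simp add: lie_action_def frechet_derivative_eq[OF D])
qed

lemma lie_action_has_derivative:
  "((\<lambda>x. \<rho> (cinv cG x) *v v) has_derivative (\<lambda>X. lie_action cG one \<rho> X v)) (at (cmap cG one))"
  using bounded_linear.has_derivative[OF bounded_linear_matrix_vector_mult_left rep_has_derivative]
  by (simp add: lie_action_eq)

lemma linear_lie_action_left: "linear (\<lambda>X. lie_action cG one \<rho> X v)"
  using lie_action_has_derivative has_derivative_linear by blast

lemma linear_lie_action_right: "linear (lie_action cG one \<rho> X)"
  by (simp add: linear_iff lie_action_eq matrix_vector_right_distrib matrix_vector_mult_scaleR)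

text \<open>The witness is the straight line through the neutral element in the chart, with velocity
  \<open>X\<close>, moved into the orbit by \<rho>. It need not be a one-parameter subgroup, since
  only its velocity at 0 enters.\<close>

lemma lie_action_in_orbit_tangent: "lie_action cG one \<rho> X v \<in> orbit_tangent \<rho> v"
proof -
  let ?x = "\<lambda>t::real. cmap cG one + t *\<^sub>R X"
  let ?\<gamma> = "\<lambda>t. \<rho> (cinv cG (?x t)) *v v"
  have "open (?x -` cimg cG)"
    using chart(3) unfolding is_chart_def
    by (intro open_vimage continuous_intros) blast
  moreover have "0 \<in> ?x -` cimg cG" using chart(2) by simp
  ultimately obtain \<epsilon> where \<epsilon>: "\<epsilon> > 0" "ball 0 \<epsilon> \<subseteq> ?x -` cimg cG"
    using open_contains_ball by blast
  then have sub: "?x t \<in> cimg cG" if "t \<in> {-\<epsilon><..<\<epsilon>}" for t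
    using that by (auto simp: subset_iff dist_real_def)
  have "smooth_on {-\<epsilon><..<\<epsilon>} ?\<gamma>"
    unfolding smooth_on_def
  proof
    fix k
    have "Ck_on k {-\<epsilon><..<\<epsilon>} (\<lambda>t. (\<rho> \<circ> cinv cG) (?x t))"
      using smooth_on_rep[unfolded smooth_on_def] sub
      by (intro Ck_on_line[where S = "cimg cG"] open_greaterThanLessThan) blast+
    then show "Ck_on k {-\<epsilon><..<\<epsilon>} ?\<gamma>"
      using Ck_on_bounded_linear_compose[OF _ bounded_linear_matrix_vector_mult_left,
          of "{-\<epsilon><..<\<epsilon>}" k "\<lambda>t. \<rho> (cinv cG (?x t))" v] by simp
  qed
  moreover have "lie_action cG one \<rho> X v = vector_derivative ?\<gamma> (at 0)"
  proof -
    have "(?x has_derivative (\<lambda>s. s *\<^sub>R X)) (at 0)"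
      by (auto intro!: derivative_eq_intros)
    moreover have "((\<lambda>x. \<rho> (cinv cG x) *v v) has_derivative (\<lambda>X. lie_action cG one \<rho> X v)) (at (?x 0))"
      using lie_action_has_derivative by simp
    ultimately have "(?\<gamma> has_derivative (\<lambda>s. lie_action cG one \<rho> (s *\<^sub>R X) v)) (at 0)"
      by (rule has_derivative_compose)
    then have "(?\<gamma> has_vector_derivative lie_action cG one \<rho> X v) (at 0)"
      using linear_scale[OF linear_lie_action_left] by (simp add: has_vector_derivative_def)
    then show ?thesis by (simp add: vector_derivative_at)
  qed
  moreover have "?\<gamma> 0 = v"
    using rep chart(2) by (simp add: chart_inverse unitary_rep_def)
  ultimately show ?thesis
    using \<epsilon>(1) unfolding orbit_tangent_def tangent_space_in_def orbit_def
    by (auto intro!: exI[of _ ?\<gamma>] exI[of _ \<epsilon>])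
qed

text \<open>Along a curve in the stabilizer with velocity \<open>X\<close> the image of
  \<open>v\<close> is constant, while the chain rule computes its velocity as the action of
  \<open>X\<close>.\<close>

lemma lie_action_stabilizer_algebra:
  assumes "X \<in> stabilizer_algebra cG one \<rho> v"
  shows "lie_action cG one \<rho> X v = 0"
proof -
  obtain \<gamma> \<epsilon> where \<gamma>: "\<epsilon> > 0" "\<gamma> 0 = one"
    "\<And>t. t \<in> {-\<epsilon><..<\<epsilon>} \<Longrightarrow> \<gamma> t \<in> stabilizer \<rho> v \<inter> cdom cG"
    "smooth_on {-\<epsilon><..<\<epsilon>} (cmap cG \<circ> \<gamma>)"
    "X = vector_derivative (cmap cG \<circ> \<gamma>) (at (0::real))"
    using assms unfolding stabilizer_algebra_def tangent_space_in_def by blast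
  have "(cmap cG \<circ> \<gamma>) differentiable (at 0)"
    using smooth_on_has_derivative[OF \<gamma>(4), of 0] \<gamma>(1) unfolding differentiable_def by auto
  then have "((\<lambda>t. cmap cG (\<gamma> t)) has_derivative (\<lambda>s. s *\<^sub>R X)) (at 0)"
    unfolding \<gamma>(5) vector_derivative_works by (simp add: has_vector_derivative_def comp_def)
  moreover have "((\<lambda>x. \<rho> (cinv cG x) *v v) has_derivative (\<lambda>X. lie_action cG one \<rho> X v))
      (at (cmap cG (\<gamma> 0)))"
    using lie_action_has_derivative \<gamma>(2) by simp
  ultimately have "((\<lambda>t. \<rho> (cinv cG (cmap cG (\<gamma> t))) *v v) has_derivative
      (\<lambda>s. lie_action cG one \<rho> (s *\<^sub>R X) v)) (at 0)"
    by (rule has_derivative_compose)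
  then have "((\<lambda>t. \<rho> (cinv cG (cmap cG (\<gamma> t))) *v v) has_vector_derivative lie_action cG one \<rho> X v) (at 0)"
    using linear_scale[OF linear_lie_action_left] by (simp add: has_vector_derivative_def)
  moreover have "((\<lambda>t. \<rho> (cinv cG (cmap cG (\<gamma> t))) *v v) has_vector_derivative 0) (at 0)"
  proof (rule has_vector_derivative_transform_within_open)
    show "((\<lambda>t. v) has_vector_derivative 0) (at 0)" by simp
    show "v = \<rho> (cinv cG (cmap cG (\<gamma> t))) *v v" if "t \<in> {-\<epsilon><..<\<epsilon>}" for t
      using \<gamma>(3)[OF that] by (simp add: chart_inverse stabilizer_def)
  qed (use \<gamma>(1) in auto)
  ultimately show ?thesis by (rule vector_derivative_unique_at)
qed

end

text \<open>Differentiability matters here because \<^const>\<open>frechet_derivative\<close> is an arbitrary choice, and in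
  particular not homogeneous, at points where a map is not differentiable.\<close>

lemma left_invariant_field_local:
  fixes \<G> :: "('a::{t2_space, second_countable_topology}, 'g::real_normed_vector) chart set"
  assumes G: "lie_group \<G> mul one ginv" and c: "cG \<in> \<G>" "one \<in> cdom cG"
  obtains S where "open S" "cmap cG one \<in> S"
    "\<And>x. x \<in> S \<Longrightarrow> linear (\<lambda>X. left_invariant_field cG mul one X x)"
    "\<And>X. left_invariant_field cG mul one X differentiable (at (cmap cG one))"
proof -
  let ?\<phi> = "cmap cG" and ?\<psi> = "cinv cG" and ?e = "cmap cG one"
  let ?P = "map_prod ?\<phi> ?\<phi>"
  let ?D = "cdom cG \<times> cdom cG"
  have atlas: "smooth_atlas \<G>" and grp: "group mul one ginv"
    and smooth: "smooth_map (prod_atlas \<G> \<G>) \<G> (\<lambda>(x, y). mul x y)"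
    using G unfolding lie_group_def by blast+
  have chart: "is_chart cG" using atlas c(1) unfolding smooth_atlas_def by blast
  then have inv: "?\<psi> (?\<phi> x) = x" if "x \<in> cdom cG" for x
    using that unfolding is_chart_def homeomorphism_def by blast
  have inj: "inj_on ?P ?D"
    by (rule inj_onI) (metis (no_types, lifting) inv map_prod_simp mem_Sigma_iff prod.collapse prod.inject)
  have one: "mul one one = one"
    using grp unfolding group_def group_axioms_def monoid_def by blast
  \<comment> \<open>\<open>F\<close> is multiplication in coordinates as a function of both factors.
    Left invariant fields are its derivatives in the second factor, so joint smoothness controls
    their dependence on the base point too.\<close>
  define U where "U = ?P ` (?D \<inter> (\<lambda>(x, y). mul x y) -` cdom cG)"
  define F where "F = (\<lambda>(x, y). ?\<phi> (mul (?\<psi> x) (?\<psi> y)))"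
  have U: "U = (cimg cG \<times> cimg cG) \<inter> (\<lambda>z. mul (?\<psi> (fst z)) (?\<psi> (snd z))) -` cdom cG"
    unfolding U_def by (force simp: inv)
  have "open U"
    unfolding U
  proof (rule continuous_open_preimage)
    have mul: "continuous_on UNIV (\<lambda>(x, y). mul x y)"
      using smooth unfolding smooth_map_def by blast
    have \<psi>: "continuous_on (cimg cG) ?\<psi>"
      using chart unfolding is_chart_def homeomorphism_def by blast
    have "continuous_on (cimg cG \<times> cimg cG) (\<lambda>z. (?\<psi> (fst z), ?\<psi> (snd z)))"
      by (intro continuous_on_Pair continuous_on_compose2[OF \<psi>] continuous_on_fst continuous_on_snd
          continuous_on_id) auto
    from continuous_on_compose2[OF mul this]
    show "continuous_on (cimg cG \<times> cimg cG) (\<lambda>z. mul (?\<psi> (fst z)) (?\<psi> (snd z)))"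
      by simp
    show "open (cimg cG \<times> cimg cG)" "open (cdom cG)"
      using chart unfolding is_chart_def by (auto intro: open_Times)
  qed
  have eU: "(?e, ?e) \<in> U"
    using c(2) one by (auto simp: U inv)
  have "smooth_on U F"
  proof -
    have "(?D, ?P) \<in> prod_atlas \<G> \<G>"
      using c(1) unfolding prod_atlas_def by force
    then have "smooth_on U (?\<phi> \<circ> (\<lambda>(x, y). mul x y) \<circ> inv_into ?D ?P)"
      using smooth c(1) unfolding smooth_map_def U_def by fastforce
    \<comment> \<open>The inverse of the product chart acts componentwise, which identifies the
      chart expression of multiplication with \<open>F\<close>.\<close>
    moreover have "(?\<phi> \<circ> (\<lambda>(x, y). mul x y) \<circ> inv_into ?D ?P) z = F z" if z: "z \<in> U" for z
    proof -
      obtain x y where xy: "x \<in> cdom cG" "y \<in> cdom cG" "z = (?\<phi> x, ?\<phi> y)"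
        using z unfolding U_def by auto
      then show ?thesis using inv_into_f_f[OF inj, of "(x, y)"] by (simp add: F_def inv)
    qed
    ultimately show ?thesis
      unfolding smooth_on_def using Ck_on_cong[OF \<open>open U\<close>] by blast
  qed
  define S where "S = (\<lambda>x. (x, ?e)) -` U"
  have "open S"
    unfolding S_def by (intro open_vimage \<open>open U\<close> continuous_intros)
  have "?e \<in> S" unfolding S_def using eU by simp
  have field: "left_invariant_field cG mul one X x = frechet_derivative F (at (x, ?e)) (0, X)"
    if "x \<in> S" for x X
  proof -
    have "((\<lambda>y. (x, y)) has_derivative (\<lambda>y. (0, y))) (at ?e)"
      by (auto intro!: derivative_eq_intros)
    from has_derivative_compose[OF this smooth_on_has_derivative[OF \<open>smooth_on U F\<close>]]
    have "(?\<phi> \<circ> mul (?\<psi> x) \<circ> ?\<psi> has_derivative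
        (\<lambda>y. frechet_derivative F (at (x, ?e)) (0, y))) (at ?e)"
      using that by (simp add: S_def F_def comp_def)
    from frechet_derivative_eq[OF this] show ?thesis
      unfolding left_invariant_field_def by simp
  qed
  show ?thesis
  proof
    show "linear (\<lambda>X. left_invariant_field cG mul one X x)" if "x \<in> S" for x
    proof -
      have "linear (frechet_derivative F (at (x, ?e)))"
        using smooth_on_has_derivative[OF \<open>smooth_on U F\<close>, of "(x, ?e)"] that has_derivative_linear
        unfolding S_def by auto
      then have "linear (frechet_derivative F (at (x, ?e)) \<circ> Pair 0)"
        by (rule linear_compose[rotated]) (simp add: linear_iff)
      then show ?thesis using field[OF that] by (simp add: comp_def)
    qed
    show "left_invariant_field cG mul one X differentiable (at ?e)" for X
    proof -
      have "((\<lambda>x. (x, ?e)) has_derivative (\<lambda>x. (x, 0))) (at ?e)"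
        by (auto intro!: derivative_eq_intros)
      from has_derivative_compose[OF this smooth_on_has_derivative[OF
            smooth_on_frechet_derivative[OF \<open>smooth_on U F\<close>, of "(0, X)"] eU]]
      obtain D where "((\<lambda>x. frechet_derivative F (at (x, ?e)) (0, X)) has_derivative D) (at ?e)"
        by blast
      then have "(left_invariant_field cG mul one X has_derivative D) (at ?e)"
        by (rule has_derivative_transform_within_open[OF _ \<open>open S\<close> \<open>?e \<in> S\<close>]) (simp add: field)
      then show ?thesis unfolding differentiable_def by blast
    qed
  qed fact+
qed

text \<open>This makes the commutator term quadratic in the scaling parameter. One factor comes from
  linearity of a derivative. The other comes from linearity of the fields in their generator, valid
  near the neutral element, which suffices because derivatives are local.\<close>

lemma lie_bracket_scaleR:
  fixes \<G> :: "('a::{t2_space, second_countable_topology}, 'g::real_normed_vector) chart set"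
  assumes "lie_group \<G> mul one ginv" "cG \<in> \<G>" "one \<in> cdom cG"
  shows "lie_bracket cG mul one (s *\<^sub>R X) (t *\<^sub>R Y) = (s * t) *\<^sub>R lie_bracket cG mul one X Y"
proof -
  let ?L = "left_invariant_field cG mul one" and ?e = "cmap cG one"
  obtain S where S: "open S" "?e \<in> S" "\<And>x. x \<in> S \<Longrightarrow> linear (\<lambda>X. ?L X x)"
    "\<And>X. ?L X differentiable (at ?e)"
    using left_invariant_field_local[OF assms] by metis
  have D: "(?L Z has_derivative frechet_derivative (?L Z) (at ?e)) (at ?e)" for Z
    using S(4) by (simp add: frechet_derivative_works)
  have "(?L (a *\<^sub>R Z) has_derivative (\<lambda>v. a *\<^sub>R frechet_derivative (?L Z) (at ?e) v)) (at ?e)" for a Z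
    by (rule has_derivative_transform_within_open[OF has_derivative_scaleR_right[OF D] S(1,2)])
      (simp add: linear_scale[OF S(3)])
  note field = frechet_derivative_eq[OF this]
  show ?thesis
    by (simp add: lie_bracket_def field linear_scale[OF has_derivative_linear[OF D]]
        scaleR_diff_right mult.commute)
qed

section \<open>Quadratic expressions in the fields\<close>

lemma orthonormal_basis_mem: "orthonormal_basis k b I W \<Longrightarrow> i \<in> I \<Longrightarrow> b i \<in> W"
  unfolding orthonormal_basis_def using span_base by blast

lemma scalar_product_orthonormal_sum:
  fixes b :: "nat \<Rightarrow> 'g::real_vector"
  assumes "scalar_product k" "finite I"
    "\<forall>i\<in>I. \<forall>j\<in>I. k (b i) (b j) = (if i = j then 1 else 0)" "i \<in> I"
  shows "k (\<Sum>j\<in>I. u j *\<^sub>R b j) (b i) = u i"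
proof -
  have l: "linear (\<lambda>x. k x y)" for y
    using assms(1) unfolding scalar_product_def bilinear_def by blast
  have "k (\<Sum>j\<in>I. u j *\<^sub>R b j) (b i) = (\<Sum>j\<in>I. u j * k (b j) (b i))"
    by (simp add: linear_sum[OF l] linear_scale[OF l])
  also have "\<dots> = (\<Sum>j\<in>I. if j = i then u i else 0)"
    using assms(3,4) by (intro sum.cong) auto
  finally show ?thesis using assms(2,4) by simp
qed

lemma orthonormal_independent:
  fixes b :: "nat \<Rightarrow> 'g::real_vector"
  assumes "scalar_product k" "finite I"
    "\<forall>i\<in>I. \<forall>j\<in>I. k (b i) (b j) = (if i = j then 1 else 0)"
  shows "inj_on b I" "independent (b ` I)"
proof -
  show inj: "inj_on b I"
    using assms(3) by (intro inj_onI) (metis zero_neq_one)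
  show "independent (b ` I)"
  proof (rule independent_if_scalars_zero)
    fix u x
    assume "(\<Sum>x\<in>b ` I. u x *\<^sub>R x) = 0" and x: "x \<in> b ` I"
    then have "(\<Sum>j\<in>I. u (b j) *\<^sub>R b j) = 0"
      by (simp add: sum.reindex[OF inj])
    moreover have "k 0 y = 0" for y
      by (rule linear_0[of "\<lambda>x. k x y"])
        (use assms(1) in \<open>simp add: scalar_product_def bilinear_def\<close>)
    ultimately show "u x = 0"
      using x scalar_product_orthonormal_sum[OF assms, of _ "u \<circ> b"] by auto
  qed (simp add: assms(2))
qed

text \<open>The finite spanning set makes the exchange lemma applicable to a basis \<open>C\<close>
  of the abstract space.\<close>

lemma independent_card_le_dim:
  fixes B S :: "'g::real_vector set"
  assumes "finite B" "span B = UNIV" "independent S"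
  shows "card S \<le> dim (UNIV :: 'g set)"
proof -
  obtain C :: "'g set" where C: "independent C" "UNIV \<subseteq> span C" "card C = dim (UNIV :: 'g set)"
    by (metis basis_exists)
  have "finite C"
    using independent_span_bound[OF assms(1) C(1)] assms(2) by simp
  from independent_span_bound[OF this assms(3)] C(2,3) show ?thesis by auto
qed

text \<open>A vector outside the span could be adjoined and would exceed the dimension. By this
  count the \<open>\<alpha> i\<close> span the Lie algebra, with no appeal to an orthogonal
  decomposition.\<close>

lemma independent_card_dim_spans:
  fixes B S :: "'g::real_vector set"
  assumes "finite B" "span B = UNIV" "independent S" "finite S" "card S = dim (UNIV :: 'g set)"
  shows "span S = UNIV"
proof (rule ccontr)
  assume "span S \<noteq> UNIV"
  then obtain v where v: "v \<notin> span S" by blast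
  then have "independent (insert v S)" and "v \<notin> S"
    using independent_insertI assms(3) by (auto simp: span_base)
  from independent_card_le_dim[OF assms(1,2) this(1)] this(2) assms(4,5) show False by simp
qed

text \<open>Rewriting a coefficient as a pairing with \<open>\<alpha> i\<close> makes it visibly
  linear, hence bounded in finite dimension.\<close>

lemma lie_coeff_orthonormal:
  fixes \<alpha> :: "nat \<Rightarrow> 'g::real_vector"
  assumes "scalar_product k" "span (\<alpha> ` {1..r}) = UNIV"
    "\<forall>i\<in>{1..r}. \<forall>j\<in>{1..r}. k (\<alpha> i) (\<alpha> j) = (if i = j then 1 else 0)"
  shows "X = (\<Sum>i=1..r. lie_coeff \<alpha> r i X *\<^sub>R \<alpha> i)"
    and "i \<in> {1..r} \<Longrightarrow> lie_coeff \<alpha> r i X = k X (\<alpha> i)"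
proof -
  note basis = orthonormal_independent[OF assms(1) finite_atLeastAtMost assms(3)]
  show *: "X = (\<Sum>i=1..r. lie_coeff \<alpha> r i X *\<^sub>R \<alpha> i)" for X
    using sum_representation_eq[OF basis(2), where v = X and B = "\<alpha> ` {1..r}"] assms(2)
    by (simp only: sum.reindex[OF basis(1)] comp_def lie_coeff_def) simp
  show "lie_coeff \<alpha> r i X = k X (\<alpha> i)" if "i \<in> {1..r}"
    by (subst (2) *) (rule scalar_product_orthonormal_sum[symmetric,
        OF assms(1) finite_atLeastAtMost assms(3) that])
qed

section \<open>Expansion of contracted squares\<close>

lemma square1_scale: "square1 h (\<lambda>\<mu>. t * a \<mu>) = t\<^sup>2 * square1 h a"
  by (simp add: square1_def sum_distrib_left sum_distrib_right power2_eq_square algebra_simps)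

lemma square2_scale: "square2 h (\<lambda>\<mu> \<nu>. t * T \<mu> \<nu>) = t\<^sup>2 * square2 h T"
  by (simp add: square2_def sum_distrib_left sum_distrib_right power2_eq_square algebra_simps)

text \<open>The higher coefficients stay existential because only the square of \<open>T\<close>
  reaches second order; what matters is that they do not depend on \<open>t\<close>.\<close>

lemma square2_expansion:
  "\<exists>b c. \<forall>t. square2 h (\<lambda>\<mu> \<nu>. t * T \<mu> \<nu> + t\<^sup>2 * S \<mu> \<nu>) = t^2 * square2 h T + t^3 * b + t^4 * c"
proof -
  define B where "B T S = (\<Sum>\<mu>\<in>UNIV. \<Sum>\<nu>\<in>UNIV. \<Sum>\<rho>\<in>UNIV. \<Sum>\<sigma>\<in>UNIV.
    h $ \<mu> $ \<rho> * h $ \<nu> $ \<sigma> * T \<rho> \<sigma> * S \<mu> \<nu>)" for T S :: "'a \<Rightarrow> 'a \<Rightarrow> real"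
  have sq: "square2 h T = B T T" for T
    by (simp add: square2_def B_def sum_distrib_right)
  have "B (\<lambda>\<mu> \<nu>. t * T \<mu> \<nu> + t\<^sup>2 * S \<mu> \<nu>) (\<lambda>\<mu> \<nu>. t * T \<mu> \<nu> + t\<^sup>2 * S \<mu> \<nu>) =
      t^2 * B T T + t^3 * (B T S + B S T) + t^4 * B S S" for t
    by (simp add: B_def sum_distrib_left flip: sum.distrib)
      (simp add: algebra_simps power2_eq_square power3_eq_cube power4_eq_xxxx)
  then show ?thesis unfolding sq by blast
qed

lemma hdot_add_left: "hdot (u + v) w = hdot u w + hdot v w"
  and hdot_add_right: "hdot u (v + w) = hdot u v + hdot u w"
  and hdot_scaleR_left: "hdot (t *\<^sub>R u) w = t *\<^sub>R hdot u w"
  and hdot_scaleR_right: "hdot u (t *\<^sub>R w) = t *\<^sub>R hdot u w"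
  by (simp_all add: hdot_def sum.distrib algebra_simps scaleR_sum_right)

lemma hdot_sum_left: "hdot (\<Sum>i\<in>I. u i) w = (\<Sum>i\<in>I. hdot (u i) w)"
  by (induction I rule: infinite_finite_induct) (simp_all add: hdot_add_left, simp_all add: hdot_def)

lemma cnj_hdot: "cnj (hdot u v) = hdot v u"
  by (simp add: hdot_def mult.commute)

text \<open>Two separate field arguments polarize the kinetic term, so that its mixed terms have a
  name.\<close>

definition hdot_square :: "real ^ 'm ^ 'm \<Rightarrow> ('m \<Rightarrow> complex ^ 'n) \<Rightarrow> ('m \<Rightarrow> complex ^ 'n) \<Rightarrow> complex"
  where "hdot_square h w z = (\<Sum>\<mu>\<in>UNIV. hdot (\<Sum>\<nu>\<in>UNIV. h $ \<mu> $ \<nu> *\<^sub>R w \<nu>) (z \<mu>))"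

text \<open>Since \<open>t\<close> is real, conjugation in the first slot leaves it alone and the
  form expands like a bilinear one.\<close>

lemma hdot_square_expansion:
  "hdot_square h (\<lambda>\<mu>. t *\<^sub>R w \<mu> + t\<^sup>2 *\<^sub>R z \<mu>) (\<lambda>\<mu>. t *\<^sub>R w \<mu> + t\<^sup>2 *\<^sub>R z \<mu>) =
    t^2 *\<^sub>R hdot_square h w w + t^3 *\<^sub>R (hdot_square h w z + hdot_square h z w) +
    t^4 *\<^sub>R hdot_square h z z"
  unfolding hdot_square_def hdot_sum_left
  by (simp add: hdot_add_left hdot_add_right hdot_scaleR_left hdot_scaleR_right scaleR_sum_right
      scaleR_add_right flip: sum.distrib)
    (simp add: algebra_simps power2_eq_square power3_eq_cube power4_eq_xxxx)

text \<open>The kinetic term is real since the antisymmetric imaginary part of the Hermitian product is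
  contracted with a symmetric matrix.\<close>

lemma hdot_square_symmetric:
  assumes "\<And>\<mu> \<nu>. h $ \<mu> $ \<nu> = h $ \<nu> $ \<mu>"
  shows "hdot_square h w w =
    complex_of_real (\<Sum>\<mu>\<in>UNIV. \<Sum>\<nu>\<in>UNIV. h $ \<mu> $ \<nu> * (w \<nu> \<bullet> w \<mu>))"
proof -
  have eq: "hdot_square h w w = (\<Sum>\<mu>\<in>UNIV. \<Sum>\<nu>\<in>UNIV. h $ \<mu> $ \<nu> *\<^sub>R hdot (w \<nu>) (w \<mu>))"
    by (simp add: hdot_square_def hdot_sum_left hdot_scaleR_left)
  have "cnj (hdot_square h w w) = (\<Sum>\<mu>\<in>UNIV. \<Sum>\<nu>\<in>UNIV. h $ \<mu> $ \<nu> *\<^sub>R hdot (w \<mu>) (w \<nu>))"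
    by (simp add: eq cnj_hdot)
  also have "\<dots> = hdot_square h w w"
    unfolding eq by (subst sum.swap) (simp add: assms)
  finally have "Im (hdot_square h w w) = 0"
    by (metis Reals_cnj_iff complex_is_Real_iff)
  then show ?thesis
    by (simp add: complex_eq_iff eq inner_eq_Re_hdot)
qed

lemma scalar_product_inner: "scalar_product ((\<bullet>) :: 'v::real_inner \<Rightarrow> 'v \<Rightarrow> real)"
  by (auto simp: scalar_product_def bilinear_def linear_iff inner_add_left inner_add_right inner_commute)

text \<open>It moves the sum over field components outside the two spacetime indices.\<close>

lemma sum_rotate3: "(\<Sum>x\<in>A. \<Sum>y\<in>B. \<Sum>z\<in>C. F x y z) = (\<Sum>z\<in>C. \<Sum>x\<in>A. \<Sum>y\<in>B. F x y z)"
  by (rule trans[OF sum.cong[OF refl sum.swap] sum.swap])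

theorem theorem7p8:
  fixes \<M> :: "('p::{t2_space, second_countable_topology}, real ^ 'm) chart set"
    and g :: "('p, real ^ 'm) chart \<Rightarrow> 'p \<Rightarrow> real ^ 'm \<Rightarrow> real ^ 'm \<Rightarrow> real"
    and \<G> :: "('a::{t2_space, second_countable_topology}, 'g::real_inner) chart set"
    and mul :: "'a \<Rightarrow> 'a \<Rightarrow> 'a" and one :: 'a and ginv :: "'a \<Rightarrow> 'a"
    and cG :: "('a, 'g) chart"
    and k :: "'g \<Rightarrow> 'g \<Rightarrow> real"
    and \<rho> :: "'a \<Rightarrow> complex ^ 'n ^ 'n"
    and V :: "complex ^ 'n \<Rightarrow> real" and v0 :: "complex ^ 'n"
    and r d :: nat
    and e f :: "nat \<Rightarrow> complex ^ 'n" and mf :: "nat \<Rightarrow> real"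
    and \<alpha> :: "nat \<Rightarrow> 'g" and M :: "nat \<Rightarrow> real"
    and \<Phi> :: "'p \<Rightarrow> complex ^ 'n" and \<xi> \<eta> :: "nat \<Rightarrow> 'p \<Rightarrow> real"
    and A :: "('p, real ^ 'm) chart \<Rightarrow> 'p \<Rightarrow> real ^ 'm \<Rightarrow> 'g"
  defines "W \<equiv> orbit_tangent \<rho> v0"
    and "\<h> \<equiv> stabilizer_algebra cG one \<rho> v0"
  assumes spacetime: "smooth_atlas \<M>"
    and metric: "riemannian_metric \<M> g \<or> lorentzian_metric \<M> g"
    and G: "lie_group \<G> mul one ginv" "compact (UNIV :: 'a set)" "connected (UNIV :: 'a set)"
    and r: "r = dim (UNIV :: 'g set)"
    and cG: "cG \<in> \<G>" "one \<in> cdom cG"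
    and k: "scalar_product k"
      "\<forall>a X Y. k (Ad cG mul one ginv a X) (Ad cG mul one ginv a Y) = k X Y"
    and rep: "unitary_rep \<G> mul one \<rho>"
    and V: "smooth_on UNIV V" "\<forall>a v. V (\<rho> a *v v) = V v"
    and vacuum: "\<forall>\<^sub>F v in nhds v0. V v0 \<le> V v"
    and d: "d = dim (ortho_complement k \<h>)"
    and e: "orthonormal_basis (\<bullet>) e {1..d} W" "\<forall>i\<in>{1..d}. hessian V v0 (e i) = 0"
    and f: "orthonormal_basis (\<bullet>) f {1..2 * CARD('n) - d} (ortho_complement (\<bullet>) W)"
      "\<forall>j\<in>{1..2 * CARD('n) - d}. mf j \<ge> 0 \<and> hessian V v0 (f j) = (2 * (mf j)\<^sup>2) *\<^sub>R f j"
    and \<alpha>: "orthonormal_basis k \<alpha> {1..d} (ortho_complement k \<h>)"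
      "orthonormal_basis k \<alpha> {d+1..r} \<h>"
      "\<forall>i\<in>{1..r}. \<forall>j\<in>{1..r}. i \<noteq> j \<longrightarrow> mass_form cG one \<rho> v0 (\<alpha> i) (\<alpha> j) = 0"
    and M: "\<forall>i\<in>{1..r}. M i \<ge> 0 \<and> mass_form cG one \<rho> v0 (\<alpha> i) (\<alpha> i) = 1/2 * (M i)\<^sup>2"
    and higgs: "smooth_map \<M> vector_space_atlas \<Phi>"
      "\<forall>p. \<Phi> p - v0 = (1 / sqrt 2) *\<^sub>R (\<Sum>i=1..d. \<xi> i p *\<^sub>R e i)
                     + (1 / sqrt 2) *\<^sub>R (\<Sum>j=1..2 * CARD('n) - d. \<eta> j p *\<^sub>R f j)"
    and unitary_gauge: "\<forall>i\<in>{1..d}. \<forall>p. \<xi> i p = 0"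
    and gauge_field: "one_form \<M> A"
  shows "\<forall>c\<in>\<M>. \<forall>p\<in>cdom c. agree_to_second_order
    (\<lambda>t. ymh_lagrangian g cG mul one \<rho> V \<alpha> r
           (\<lambda>q. v0 + t *\<^sub>R (\<Phi> q - v0)) (\<lambda>c q u. t *\<^sub>R A c q u) c p
         + complex_of_real (V v0))
    (\<lambda>t. complex_of_real (broken_lagrangian g \<alpha> r d (2 * CARD('n) - d) mf M
           (\<lambda>j q. t * \<eta> j q) (\<lambda>c q u. t *\<^sub>R A c q u) c p))"
proof (intro ballI)
  fix c p
  assume c: "c \<in> \<M>" and p: "p \<in> cdom c"
  let ?N = "2 * CARD('n) - d"
  have atlas: "smooth_atlas \<G>" using G(1) unfolding lie_group_def by blast
  have chart: "is_chart cG" using atlas cG(1) unfolding smooth_atlas_def by blast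
  \<comment> \<open>Finite dimension of the Lie algebra is part of having a smooth atlas on the
    group.\<close>
  obtain B0 :: "'g set" where B0: "finite B0" "span B0 = UNIV"
    using atlas unfolding smooth_atlas_def by blast
  have x: "cmap c p \<in> cimg c" using p by blast

  \<comment> \<open>The adapted orthonormal basis of the Lie algebra\<close>
  have k_bilinear: "bilinear k" and k_sym: "k X Y = k Y X" for X Y
    using k(1) unfolding scalar_product_def by blast+
  have k_lin: "linear (\<lambda>X. k X Y)" for Y
    using k_bilinear unfolding bilinear_def by blast
  have \<alpha>_perp: "\<forall>i\<in>{1..d}. \<forall>j\<in>{1..d}. k (\<alpha> i) (\<alpha> j) = (if i = j then 1 else 0)"
    using \<alpha>(1) unfolding orthonormal_basis_def by blast
  have "card (\<alpha> ` {1..d}) \<le> r"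
    unfolding r using orthonormal_independent(2)[OF k(1) finite_atLeastAtMost \<alpha>_perp]
    by (intro independent_card_le_dim[OF B0]) simp
  then have dr: "d \<le> r"
    using card_image[OF orthonormal_independent(1)[OF k(1) finite_atLeastAtMost \<alpha>_perp]] by simp
  have \<alpha>_in_\<h>: "\<alpha> i \<in> \<h>" if "i \<in> {d+1..r}" for i
    using orthonormal_basis_mem[OF \<alpha>(2) that] .
  have \<alpha>_in_perp: "\<alpha> i \<in> ortho_complement k \<h>" if "i \<in> {1..d}" for i
    using orthonormal_basis_mem[OF \<alpha>(1) that] .
  have \<alpha>_orth: "\<forall>i\<in>{1..r}. \<forall>j\<in>{1..r}. k (\<alpha> i) (\<alpha> j) = (if i = j then 1 else 0)"
  proof (intro ballI)
    fix i j
    assume ij: "i \<in> {1..r}" "j \<in> {1..r}"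
    consider "i \<in> {1..d}" "j \<in> {1..d}" | "i \<in> {d+1..r}" "j \<in> {d+1..r}"
      | "i \<in> {1..d}" "j \<in> {d+1..r}" | "i \<in> {d+1..r}" "j \<in> {1..d}"
      using ij by fastforce
    then show "k (\<alpha> i) (\<alpha> j) = (if i = j then 1 else 0)"
    proof cases
      case 1
      then show ?thesis using \<alpha>_perp by blast
    next
      case 2
      then show ?thesis using \<alpha>(2) unfolding orthonormal_basis_def by blast
    next
      case 3
      then show ?thesis
        using \<alpha>_in_perp[of i] \<alpha>_in_\<h>[of j] unfolding ortho_complement_def by auto
    next
      case 4
      then show ?thesis
        using \<alpha>_in_perp[of j] \<alpha>_in_\<h>[of i] unfolding ortho_complement_def by (auto simp: k_sym)
    qed
  qed
  note \<alpha>_basis = orthonormal_independent[OF k(1) finite_atLeastAtMost \<alpha>_orth]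
  have "span (\<alpha> ` {1..r}) = UNIV"
    using \<alpha>_basis card_image[OF \<alpha>_basis(1)] r by (intro independent_card_dim_spans[OF B0]) auto
  note coeff = lie_coeff_orthonormal[OF k(1) this \<alpha>_orth]
  have coeff_bounded: "bounded_linear (lie_coeff \<alpha> r i)" if "i \<in> {1..r}" for i
    using linear_imp_bounded_linear_finite_span[OF B0 k_lin] coeff(2)[OF that] by presburger

  \<comment> \<open>Fields at the point and their order in the scaling parameter\<close>
  define h where "h = inverse_metric g c p"
  define P where "P \<mu> = A c p (axis \<mu> 1)" for \<mu>
  define D where "D \<mu> = partial_deriv c \<mu> \<Phi> p" for \<mu>
  define \<Delta> where "\<Delta> = \<Phi> p - v0"
  define act where "act = lie_action cG one \<rho>"
  define lc where "lc = lie_coeff \<alpha> r"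
  \<comment> \<open>Acting on the constant vacuum vector, the gauge field is of first order; acting
    on the shifted field, of second.\<close>
  define w where "w \<mu> = D \<mu> + act (P \<mu>) v0" for \<mu>
  define z where "z \<mu> = act (P \<mu>) \<Delta>" for \<mu>
  define E where "E \<mu> \<nu> = ext_deriv A c \<mu> \<nu> p" for \<mu> \<nu>
  define K where "K \<mu> \<nu> = lie_bracket cG mul one (P \<mu>) (P \<nu>)" for \<mu> \<nu>
  have h_sym: "h $ \<mu> $ \<nu> = h $ \<nu> $ \<mu>" for \<mu> \<nu>
    unfolding h_def by (rule inverse_metric_symmetric[OF metric c p])
  note act_lin = linear_lie_action_left[OF cG chart rep, folded act_def]
    linear_lie_action_right[OF cG chart rep, folded act_def]
  have lc_lin: "linear (lc i)" if "i \<in> {1..r}" for i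
    using coeff_bounded[OF that] unfolding lc_def by (rule bounded_linear.linear)

  have \<Phi>_diff: "(\<Phi> \<circ> cinv c) differentiable (at (cmap c p))"
    using smooth_on_has_derivative[OF smooth_map_vector_space[OF higgs(1) c] x]
    unfolding differentiable_def by blast
  have A_diff: "((\<lambda>q. A c q u) \<circ> cinv c) differentiable (at (cmap c p))" for u
    using gauge_field c smooth_on_has_derivative[OF _ x, of "(\<lambda>q. A c q u) \<circ> cinv c"]
    unfolding differentiable_def one_form_def comp_def by blast
  \<comment> \<open>Both the rescaling of the gauge field and the passage to its real coefficients
    are instances of \<open>L\<close>.\<close>
  have ext: "ext_deriv (\<lambda>c q u. L (A c q u)) c \<mu> \<nu> p = L (E \<mu> \<nu>)" if L: "bounded_linear L"
    for L :: "'g \<Rightarrow> 'v::real_normed_vector" and \<mu> \<nu>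
    using partial_deriv_bounded_linear[OF L A_diff, of _ 0]
    by (simp add: ext_deriv_def E_def linear_diff[OF bounded_linear.linear[OF L]])

  have cov: "cov_deriv cG one \<rho> (\<lambda>c q u. t *\<^sub>R A c q u) (\<lambda>q. v0 + t *\<^sub>R (\<Phi> q - v0)) c \<mu> p =
      t *\<^sub>R w \<mu> + t\<^sup>2 *\<^sub>R z \<mu>" for t \<mu>
  proof -
    have "partial_deriv c \<mu> (\<lambda>q. v0 + t *\<^sub>R (\<Phi> q - v0)) p = t *\<^sub>R D \<mu>"
      using partial_deriv_bounded_linear[OF bounded_linear_scaleR_right \<Phi>_diff, of \<mu> "v0 - t *\<^sub>R v0" t]
      by (simp add: D_def algebra_simps)
    then show ?thesis
      by (simp add: cov_deriv_def w_def z_def act_def[symmetric] P_def[symmetric] \<Delta>_def[symmetric]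
          linear_scale[OF act_lin(1)] linear_scale[OF act_lin(2)] linear_add[OF act_lin(2)]
          scaleR_add_right power2_eq_square)
  qed
  have field: "lc i (field_strength cG mul one (\<lambda>c q u. t *\<^sub>R A c q u) c \<mu> \<nu> p) =
      t * lc i (E \<mu> \<nu>) + t\<^sup>2 * lc i (K \<mu> \<nu>)" if "i \<in> {1..r}" for t \<mu> \<nu> i
    using lie_bracket_scaleR[OF G(1) cG]
    by (simp add: field_strength_def ext[OF bounded_linear_scaleR_right] P_def[symmetric]
        K_def[symmetric] linear_scale[OF lc_lin[OF that]] linear_add[OF lc_lin[OF that]]
        power2_eq_square)

  \<comment> \<open>Higgs coordinates in unitary gauge\<close>
  have f_orth: "\<forall>i\<in>{1..?N}. \<forall>j\<in>{1..?N}. f i \<bullet> f j = (if i = j then 1 else 0)"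
    using f(1) unfolding orthonormal_basis_def by blast
  have f_perp: "f j \<bullet> v = 0" if "j \<in> {1..?N}" "v \<in> W" for j v
  proof -
    have "f j \<in> ortho_complement (\<bullet>) W"
      using orthonormal_basis_mem[OF f(1) that(1)] .
    then show ?thesis using that(2) unfolding ortho_complement_def by blast
  qed
  have shifted: "\<Phi> q - v0 = (\<Sum>j=1..?N. (\<eta> j q / sqrt 2) *\<^sub>R f j)" for q
    using higgs(2) unitary_gauge by (simp add: scaleR_sum_right divide_inverse mult.commute)
  \<comment> \<open>Each \<open>\<eta> j\<close> is thereby an affine function of \<Phi> and
    inherits its differentiability; the factor \<open>sqrt 2\<close> undoes the normalization of the
    expansion.\<close>
  have \<eta>: "\<eta> j q = sqrt 2 * ((\<Phi> q - v0) \<bullet> f j)" if "j \<in> {1..?N}" for j q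
    unfolding shifted scalar_product_orthonormal_sum[OF scalar_product_inner finite_atLeastAtMost f_orth that]
    by simp
  have d\<eta>: "partial_deriv c \<mu> (\<lambda>q. t * \<eta> j q) p = t * (sqrt 2 * (D \<mu> \<bullet> f j))"
    if "j \<in> {1..?N}" for j t \<mu>
  proof -
    have "bounded_linear (\<lambda>v. t * (sqrt 2 * (v \<bullet> f j)))"
      by (intro bounded_linear_const_mult bounded_linear_inner_left)
    from partial_deriv_bounded_linear[OF this \<Phi>_diff, of \<mu> "- (t * (sqrt 2 * (v0 \<bullet> f j)))"]
    show ?thesis by (simp add: \<eta>[OF that] D_def inner_diff_left algebra_simps)
  qed
  \<comment> \<open>The projection \<open>Pr\<close> fixes the shifted field, so \<Phi> is an affine
    image of itself under \<open>Pr\<close>; differentiating this identity shows that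
    \<open>Pr\<close> fixes its derivatives as well.\<close>
  have D_expand: "D \<mu> = (\<Sum>j=1..?N. (D \<mu> \<bullet> f j) *\<^sub>R f j)" for \<mu>
  proof -
    define Pr where "Pr v = (\<Sum>j=1..?N. (v \<bullet> f j) *\<^sub>R f j)" for v
    have bl: "bounded_linear Pr"
      unfolding Pr_def[abs_def]
      by (intro bounded_linear_sum bounded_linear_scaleR_left[THEN bounded_linear_compose]
          bounded_linear_inner_left)
    have "Pr (\<Phi> q - v0) = (\<Sum>j=1..?N. (\<eta> j q / sqrt 2) *\<^sub>R f j)" for q
      unfolding Pr_def by (intro sum.cong refl) (simp add: \<eta>)
    then have "Pr (\<Phi> q) - Pr v0 = \<Phi> q - v0" for q
      by (simp only: linear_diff[OF bounded_linear.linear[OF bl], symmetric] shifted)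
    then have eq: "(\<lambda>q. (v0 - Pr v0) + Pr (\<Phi> q)) = \<Phi>"
      by (simp add: fun_eq_iff algebra_simps)
    have "D \<mu> = Pr (D \<mu>)"
      using partial_deriv_bounded_linear[OF bl \<Phi>_diff, of \<mu> "v0 - Pr v0"]
      unfolding eq D_def .
    then show ?thesis unfolding Pr_def .
  qed

  \<comment> \<open>Orthogonality of Higgs and gauge directions, and the mass form\<close>
  have act_W: "act X v0 \<in> W" for X
    unfolding act_def W_def by (rule lie_action_in_orbit_tangent[OF cG chart rep])
  have D_act: "D \<mu> \<bullet> act X v0 = 0" for \<mu> X
    by (subst D_expand) (simp add: inner_sum_left f_perp act_W)
  have D_D: "D \<nu> \<bullet> D \<mu> = (\<Sum>j=1..?N. (D \<nu> \<bullet> f j) * (D \<mu> \<bullet> f j))" for \<mu> \<nu>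
    by (subst (1) D_expand) (simp add: inner_sum_left inner_commute[of "f j" for j])
  \<comment> \<open>Generators in \<h> annihilate the vacuum vector; this later cuts the mass sum at
    \<open>d\<close>.\<close>
  have M_unbroken: "(M i)\<^sup>2 = 0" if "i \<in> {d+1..r}" for i
  proof -
    have "lie_action cG one \<rho> (\<alpha> i) v0 = 0"
      using lie_action_stabilizer_algebra[OF cG chart rep] \<alpha>_in_\<h>[OF that] by (simp add: \<h>_def)
    then have "mass_form cG one \<rho> v0 (\<alpha> i) (\<alpha> i) = 0" by (simp add: mass_form_def)
    moreover have "mass_form cG one \<rho> v0 (\<alpha> i) (\<alpha> i) = 1/2 * (M i)\<^sup>2"
      using M that by auto
    ultimately show ?thesis by simp
  qed
  have act_act: "act X v0 \<bullet> act Y v0 = (\<Sum>i=1..d. 1/2 * (M i)\<^sup>2 * (lc i X * lc i Y))" for X Y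
  proof -
    have expand: "act X v0 = (\<Sum>i=1..r. lc i X *\<^sub>R act (\<alpha> i) v0)" for X
      by (subst (1) coeff(1)) (simp add: linear_sum[OF act_lin(1)] linear_scale[OF act_lin(1)] lc_def)
    have "act X v0 \<bullet> act Y v0 = (\<Sum>i=1..r. lc i X * (act (\<alpha> i) v0 \<bullet> act Y v0))"
      by (simp only: expand[of X] inner_sum_left inner_scaleR_left)
    also have "\<dots> = (\<Sum>i=1..r. \<Sum>j=1..r. lc i X * lc j Y * mass_form cG one \<rho> v0 (\<alpha> i) (\<alpha> j))"
      by (simp only: expand[of Y] inner_sum_right inner_scaleR_right mass_form_def
          act_def[symmetric] sum_distrib_left mult.assoc)
    also have "\<dots> = (\<Sum>i=1..r. \<Sum>j=1..r. if j = i then 1/2 * (M i)\<^sup>2 * (lc i X * lc i Y) else 0)"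
      using \<alpha>(3) M by (intro sum.cong refl) auto
    also have "\<dots> = (\<Sum>i=1..r. 1/2 * (M i)\<^sup>2 * (lc i X * lc i Y))"
      by simp
    also have "\<dots> = (\<Sum>i=1..d. 1/2 * (M i)\<^sup>2 * (lc i X * lc i Y))"
      using dr M_unbroken by (intro sum.mono_neutral_right) auto
    finally show ?thesis .
  qed

  \<comment> \<open>Quadratic part of the kinetic term\<close>
  have kinetic: "hdot_square h w w = complex_of_real
      (1/2 * (\<Sum>j=1..?N. square1 h (\<lambda>\<mu>. sqrt 2 * (D \<mu> \<bullet> f j)))
       + 1/2 * (\<Sum>i=1..d. (M i)\<^sup>2 * square1 h (\<lambda>\<mu>. lc i (P \<mu>))))"
  proof -
    have "w \<nu> \<bullet> w \<mu> = D \<nu> \<bullet> D \<mu> + act (P \<nu>) v0 \<bullet> act (P \<mu>) v0" for \<mu> \<nu>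
      unfolding w_def inner_add_left inner_add_right D_act
      by (simp add: D_act inner_commute[of "act _ _" "D _"])
    then have "(\<Sum>\<mu>\<in>UNIV. \<Sum>\<nu>\<in>UNIV. h $ \<mu> $ \<nu> * (w \<nu> \<bullet> w \<mu>)) =
        (\<Sum>\<mu>\<in>UNIV. \<Sum>\<nu>\<in>UNIV. \<Sum>j=1..?N. h $ \<mu> $ \<nu> * (D \<nu> \<bullet> f j) * (D \<mu> \<bullet> f j)) +
        (\<Sum>\<mu>\<in>UNIV. \<Sum>\<nu>\<in>UNIV. \<Sum>i=1..d. 1/2 * (M i)\<^sup>2 * (h $ \<mu> $ \<nu> * lc i (P \<nu>) * lc i (P \<mu>)))"
      by (simp add: D_D act_act distrib_left sum.distrib sum_distrib_left mult_ac)
    also have "(\<Sum>\<mu>\<in>UNIV. \<Sum>\<nu>\<in>UNIV. \<Sum>j=1..?N. h $ \<mu> $ \<nu> * (D \<nu> \<bullet> f j) * (D \<mu> \<bullet> f j)) =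
        (\<Sum>j=1..?N. square1 h (\<lambda>\<mu>. D \<mu> \<bullet> f j))"
      unfolding square1_def sum_distrib_right by (rule sum_rotate3)
    also have "(\<Sum>\<mu>\<in>UNIV. \<Sum>\<nu>\<in>UNIV. \<Sum>i=1..d. 1/2 * (M i)\<^sup>2 * (h $ \<mu> $ \<nu> * lc i (P \<nu>) * lc i (P \<mu>))) =
        (\<Sum>i=1..d. 1/2 * (M i)\<^sup>2 * square1 h (\<lambda>\<mu>. lc i (P \<mu>)))"
      unfolding square1_def sum_distrib_right sum_distrib_left by (rule sum_rotate3)
    \<comment> \<open>The factor \<open>sqrt 2\<close> leaves the square as 2 and cancels the
      1/2.\<close>
    finally show ?thesis
      by (simp add: hdot_square_symmetric[OF h_sym] square1_scale sum_distrib_left)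
  qed

  \<comment> \<open>Quadratic part of the potential\<close>
  have potential: "1/2 * (\<Delta> \<bullet> hessian V v0 \<Delta>) = 1/2 * (\<Sum>j=1..?N. (mf j)\<^sup>2 * (\<eta> j p)\<^sup>2)"
  proof -
    have "hessian V v0 \<Delta> = (\<Sum>j=1..?N. (\<eta> j p / sqrt 2) *\<^sub>R hessian V v0 (f j))"
      by (simp add: \<Delta>_def shifted linear_sum[OF linear_hessian[OF V(1)]]
          linear_scale[OF linear_hessian[OF V(1)]])
    also have "\<dots> = (\<Sum>j=1..?N. (\<eta> j p / sqrt 2 * (2 * (mf j)\<^sup>2)) *\<^sub>R f j)"
      using f(2) by (intro sum.cong) auto
    finally have "\<Delta> \<bullet> hessian V v0 \<Delta> = (\<Sum>j=1..?N. \<eta> j p / sqrt 2 * (2 * (mf j)\<^sup>2) * (\<Delta> \<bullet> f j))"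
      by (simp add: inner_sum_right)
    also have "\<dots> = (\<Sum>j=1..?N. (mf j)\<^sup>2 * (\<eta> j p)\<^sup>2)"
    \<comment> \<open>Each of the two copies of \<Delta> brings a factor 1 / \<open>sqrt 2\<close>;
      together they cancel the 2 in the Hessian eigenvalue.\<close>
    proof (rule sum.cong)
      fix j assume "j \<in> {1..?N}"
      then have coord: "\<Delta> \<bullet> f j = \<eta> j p / sqrt 2" using \<eta>[of j p] by (simp add: \<Delta>_def)
      show "\<eta> j p / sqrt 2 * (2 * (mf j)\<^sup>2) * (\<Delta> \<bullet> f j) = (mf j)\<^sup>2 * (\<eta> j p)\<^sup>2"
        unfolding coord by (simp add: power2_eq_square)
    qed simp
    finally show ?thesis by simp
  qed

  \<comment> \<open>Comparison of the two Lagrangians\<close>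
  define S where "S i = square2 h (\<lambda>\<mu> \<nu>. lc i (E \<mu> \<nu>))" for i
  \<comment> \<open>The remainder coefficients are chosen for each \<open>i\<close> once and for all
    \<open>t\<close>, so that their sums can serve as polynomial coefficients.\<close>
  have "\<forall>i. \<exists>b c. \<forall>t. square2 h (\<lambda>\<mu> \<nu>. t * lc i (E \<mu> \<nu>) + t\<^sup>2 * lc i (K \<mu> \<nu>)) =
      t^2 * S i + t^3 * b + t^4 * c"
    unfolding S_def by (intro allI square2_expansion)
  then obtain b4 c4 where gauge: "\<And>i t.
      square2 h (\<lambda>\<mu> \<nu>. t * lc i (E \<mu> \<nu>) + t\<^sup>2 * lc i (K \<mu> \<nu>)) = t^2 * S i + t^3 * b4 i + t^4 * c4 i"
    unfolding choice_iff by blast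
  define L where "L = 1/2 * (\<Sum>j=1..?N. square1 h (\<lambda>\<mu>. sqrt 2 * (D \<mu> \<bullet> f j)))
     - 1/2 * (\<Sum>j=1..?N. (mf j)\<^sup>2 * (\<eta> j p)\<^sup>2)
     - 1/4 * (\<Sum>i=1..d. S i)
     + 1/2 * (\<Sum>i=1..d. (M i)\<^sup>2 * square1 h (\<lambda>\<mu>. lc i (P \<mu>)))
     - 1/4 * (\<Sum>i=d+1..r. S i)"

  \<comment> \<open>The right-hand side is homogeneous of degree two in the fields, so this is an
    exact equality.\<close>
  have broken: "broken_lagrangian g \<alpha> r d ?N mf M (\<lambda>j q. t * \<eta> j q) (\<lambda>c q u. t *\<^sub>R A c q u) c p
      = t\<^sup>2 * L" for t
  proof -
    have "square2 h (\<lambda>\<mu> \<nu>. ext_deriv (\<lambda>c q u. lc i (t *\<^sub>R A c q u)) c \<mu> \<nu> p) = t\<^sup>2 * S i"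
      if "i \<in> {1..r}" for i
    proof -
      have "bounded_linear (\<lambda>X. lc i (t *\<^sub>R X))"
        unfolding lc_def
        by (intro bounded_linear_compose[OF coeff_bounded[OF that]] bounded_linear_scaleR_right)
      from ext[OF this] show ?thesis
        by (simp add: linear_scale[OF lc_lin[OF that]] square2_scale S_def)
    qed
    then have "(\<Sum>i=1..d. square2 h (\<lambda>\<mu> \<nu>. ext_deriv (\<lambda>c q u. lc i (t *\<^sub>R A c q u)) c \<mu> \<nu> p)) =
          t\<^sup>2 * (\<Sum>i=1..d. S i)"
      and "(\<Sum>i=d+1..r. square2 h (\<lambda>\<mu> \<nu>. ext_deriv (\<lambda>c q u. lc i (t *\<^sub>R A c q u)) c \<mu> \<nu> p)) =
          t\<^sup>2 * (\<Sum>i=d+1..r. S i)"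
      using dr by (auto simp: sum_distrib_left intro!: sum.cong)
    moreover have "(\<Sum>j=1..?N. square1 h (\<lambda>\<mu>. partial_deriv c \<mu> (\<lambda>q. t * \<eta> j q) p)) =
        t\<^sup>2 * (\<Sum>j=1..?N. square1 h (\<lambda>\<mu>. sqrt 2 * (D \<mu> \<bullet> f j)))"
      unfolding sum_distrib_left by (intro sum.cong refl) (simp only: d\<eta> square1_scale)
    moreover have "(\<Sum>i=1..d. (M i)\<^sup>2 * square1 h (\<lambda>\<mu>. lc i (t *\<^sub>R P \<mu>))) =
        t\<^sup>2 * (\<Sum>i=1..d. (M i)\<^sup>2 * square1 h (\<lambda>\<mu>. lc i (P \<mu>)))"
      unfolding sum_distrib_left
      using dr by (intro sum.cong refl) (simp add: linear_scale[OF lc_lin] square1_scale)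
    moreover have "(\<Sum>j=1..?N. (mf j)\<^sup>2 * (t * \<eta> j p)\<^sup>2) = t\<^sup>2 * (\<Sum>j=1..?N. (mf j)\<^sup>2 * (\<eta> j p)\<^sup>2)"
      by (simp add: sum_distrib_left power_mult_distrib mult.left_commute)
    ultimately show ?thesis
      unfolding broken_lagrangian_def Let_def h_def[symmetric] lc_def[symmetric] P_def[symmetric] L_def
      by (simp only:) (simp add: algebra_simps)
  qed
  \<comment> \<open>All terms except the potential form an exact polynomial in \<open>t\<close>; the
    potential is kept apart for its Taylor expansion.\<close>
  have ymh: "ymh_lagrangian g cG mul one \<rho> V \<alpha> r
      (\<lambda>q. v0 + t *\<^sub>R (\<Phi> q - v0)) (\<lambda>c q u. t *\<^sub>R A c q u) c p + complex_of_real (V v0) =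
      (t^2 *\<^sub>R (hdot_square h w w - complex_of_real (1/4 * (\<Sum>i=1..r. S i)))
       + t^3 *\<^sub>R (hdot_square h w z + hdot_square h z w - complex_of_real (1/4 * (\<Sum>i=1..r. b4 i)))
       + t^4 *\<^sub>R (hdot_square h z z - complex_of_real (1/4 * (\<Sum>i=1..r. c4 i))))
      + (complex_of_real (- V (v0 + t *\<^sub>R \<Delta>)) + complex_of_real (V v0))" for t
  proof -
    have "(\<Sum>i=1..r. square2 h (\<lambda>\<mu> \<nu>.
        lc i (field_strength cG mul one (\<lambda>c q u. t *\<^sub>R A c q u) c \<mu> \<nu> p))) =
        t^2 * (\<Sum>i=1..r. S i) + t^3 * (\<Sum>i=1..r. b4 i) + t^4 * (\<Sum>i=1..r. c4 i)"
      by (simp add: field gauge sum.distrib sum_distrib_left)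
    then show ?thesis
      unfolding ymh_lagrangian_def cov h_def[symmetric] lc_def[symmetric] \<Delta>_def[symmetric]
        hdot_square_def[symmetric] hdot_square_expansion
      by (simp add: scaleR_conv_of_real algebra_simps)
  qed
  \<comment> \<open>The coefficient \<open>- 0\<close> is the vanishing first order term of
    \<open>V\<close> after applying the linear map that negates and embeds into the complex
    numbers.\<close>
  have "taylor2 (\<lambda>t. complex_of_real (- V (v0 + t *\<^sub>R \<Delta>))) (complex_of_real (- V v0))
      (complex_of_real (- 0)) (complex_of_real (- (1/2 * (\<Delta> \<bullet> hessian V v0 \<Delta>))))"
    by (rule taylor2_bounded_linear[OF bounded_linear_compose[OF bounded_linear_of_real
            bounded_linear_minus[OF bounded_linear_ident]] taylor2_local_minimum[OF V(1) vacuum]])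
  note left = taylor2_add[OF taylor2_quartic taylor2_add[OF this taylor2_const]]
  have second_order: "hdot_square h w w - complex_of_real (1/4 * (\<Sum>i=1..r. S i))
      + (complex_of_real (- (1/2 * (\<Delta> \<bullet> hessian V v0 \<Delta>))) + 0) = complex_of_real L"
  proof -
    have "(\<Sum>i=1..r. S i) = (\<Sum>i=1..d. S i) + (\<Sum>i=d+1..r. S i)"
      using dr sum.ub_add_nat[of 1 d S "r - d"] by simp
    then show ?thesis
      unfolding kinetic potential L_def by (simp add: add_divide_distrib)
  qed
  have "taylor2 (\<lambda>t. ymh_lagrangian g cG mul one \<rho> V \<alpha> r
           (\<lambda>q. v0 + t *\<^sub>R (\<Phi> q - v0)) (\<lambda>c q u. t *\<^sub>R A c q u) c p
         + complex_of_real (V v0))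
      (0 + (complex_of_real (- V v0) + complex_of_real (V v0))) (0 + (complex_of_real (- 0) + 0))
      (complex_of_real L)"
    unfolding ymh second_order[symmetric] by (rule left)
  then have "taylor2 (\<lambda>t. ymh_lagrangian g cG mul one \<rho> V \<alpha> r
           (\<lambda>q. v0 + t *\<^sub>R (\<Phi> q - v0)) (\<lambda>c q u. t *\<^sub>R A c q u) c p
         + complex_of_real (V v0)) 0 0 (complex_of_real L)"
    by simp
  moreover have "taylor2 (\<lambda>t. complex_of_real (broken_lagrangian g \<alpha> r d ?N mf M
           (\<lambda>j q. t * \<eta> j q) (\<lambda>c q u. t *\<^sub>R A c q u) c p)) 0 0 (complex_of_real L)"
    unfolding broken using taylor2_quartic[of "complex_of_real L" 0 0]
    by (simp add: scaleR_conv_of_real)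
  ultimately show "agree_to_second_order
    (\<lambda>t. ymh_lagrangian g cG mul one \<rho> V \<alpha> r
           (\<lambda>q. v0 + t *\<^sub>R (\<Phi> q - v0)) (\<lambda>c q u. t *\<^sub>R A c q u) c p
         + complex_of_real (V v0))
    (\<lambda>t. complex_of_real (broken_lagrangian g \<alpha> r d ?N mf M
           (\<lambda>j q. t * \<eta> j q) (\<lambda>c q u. t *\<^sub>R A c q u) c p))"
    unfolding agree_to_second_order_def by blast
qed

end
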